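(* Let $a \in \mathbb{R}$ and let $I=(a,\infty)$. Let $A \subset I$ be a finite set with $|A|\geq 2$, and let $f: I \to \mathbb{R}$ be a strictly convex or strictly concave function. For each $d \in (0,\infty)$ let $f_d : I \to J$ be given by $f_d(x) = f(x+d)-f(x)$, where $J=J_d$ denotes the range of $f_d$. Suppose that, for every $d \in (0,\infty)$, the inverse function $f_d^{-1}: J \to I$ is $3$-convex. Then \[ \max\{|16A|, |13f(A)|\} \gtrsim |A|^{\frac{3}{2}+\frac{1}{162}}. \]
   Context: For finite $X \subset \mathbb{R}$ and $k\in\mathbb{N}$, $kX := \{x_1+\dots+x_k : x_i \in X\}$, and $f(A) := \{f(x): x \in A\}$; $|\cdot|$ denotes cardinality. Since $f$ is strictly convex or strictly concave, each $f_d$ is strictly monotone and its range $J$ is an interval, so $f_d^{-1}: J\to I$ is well defined. For an interval $J$ and $k \ge 1$, a function $g: J \to \mathbb{R}$ is called $k$-convex on $J$ if each of the derivatives $g^{(1)},\dots,g^{(k+1)}$ exists on $J$ and $g^{(j)}(x)\neq 0$ for all $x \in J$ and all $1\leq j\leq k+1$. $X \gtrsim Y$ means that $X \geq c_0\, Y/(\log Y)^{c}$ for some absolute constants $c_0,c>0$ (understood for $Y \geq 2$), where $\log$ is the logarithm to base $2$. *)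

theory Defs
  imports "HOL-Analysis.Analysis"
begin

definition iterated_sumset :: "nat \<Rightarrow> real set \<Rightarrow> real set" where
  "iterated_sumset k X = {\<Sum>i<k. x i | x. \<forall>i<k. x i \<in> X}"

definition strictly_convex_on :: "real set \<Rightarrow> (real \<Rightarrow> real) \<Rightarrow> bool" where
  "strictly_convex_on S f \<longleftrightarrow> convex S \<and>
    (\<forall>x\<in>S. \<forall>y\<in>S. x \<noteq> y \<longrightarrow> (\<forall>u>0. \<forall>v>0. u + v = 1 \<longrightarrow>
      f (u *\<^sub>R x + v *\<^sub>R y) < u * f x + v * f y))"

definition strictly_concave_on :: "real set \<Rightarrow> (real \<Rightarrow> real) \<Rightarrow> bool" where
  "strictly_concave_on S f \<longleftrightarrow> strictly_convex_on S (\<lambda>x. - f x)"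

(* G j is the j-th derivative of g on J. Derivatives are taken within J, so that only the
   values of g on J matter; at interior points of J they are the ordinary derivatives, at an
   endpoint belonging to J the one-sided ones. They are unique for nondegenerate intervals J. *)
definition k_convex_on :: "nat \<Rightarrow> real set \<Rightarrow> (real \<Rightarrow> real) \<Rightarrow> bool" where
  "k_convex_on k J g \<longleftrightarrow> (\<exists>G :: nat \<Rightarrow> real \<Rightarrow> real. G 0 = g \<and>
    (\<forall>j\<le>k. \<forall>x\<in>J. (G j has_real_derivative G (Suc j) x) (at x within J)) \<and>
    (\<forall>j\<in>{1..k+1}. \<forall>x\<in>J. G j x \<noteq> 0))"

definition fwd_diff :: "(real \<Rightarrow> real) \<Rightarrow> real \<Rightarrow> real \<Rightarrow> real" where
  "fwd_diff f d x = f (x + d) - f x"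

end

theory Submission
  imports Defs
begin

text \<open>
  After passing to half of A and possibly replacing f by its negative, f increases on A. Write
  n = |A| and let M bound |16A| and |13f(A)|.

  Many consecutive gaps of A take a popular value d: if A + A - A has N elements, then most gaps
  are shared by about n^2/N consecutive pairs. For a popular d let B be (half of) the set of
  differences f(x+d) - f(x) over these pairs. The elements of B + B - B between the minimum and
  the maximum of B can be squeezed, by monotonicity, between consecutive elements of f(A).
  So if 4f(A) - 3f(A) has M1 elements, then for some popular d this local part of B + B - B has
  size O(M1/n). Iterating the same squeezing on B, the 3-convex inverse of x \<mapsto> f(x+d) - f(x) maps
  B into A with growth |8A - 7A| \<ge> c |B|^15 / (M1/n)^11 \<ge> c n^41 / (N^15 M1^11).

  Ruzsa's triangle inequality with the sets 8A and 8f(A) bounds |8A - 7A|, N and M1 by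
  M^2/|8A|, M^2/|8A| and M^2/|8f(A)|. For translates of a convex curve the Szemeredi-Trotter bound
  in a grid has an elementary proof (cut the grid into blocks; two points determine the translate),
  and iterating it gives |8A||8f(A)| \<ge> c n^(383/128). Altogether M^472 \<ge> c n^711, and
  711/472 > 122/81 = 3/2 + 1/162, so the logarithmic factor is not even needed.
\<close>

section \<open>Iterated sumsets and Ruzsa's triangle inequality\<close>

lemma iterated_sumset_0 [simp]: "iterated_sumset 0 X = {0}"
  by (auto simp: iterated_sumset_def)

lemma iterated_sumset_Suc:
  "iterated_sumset (Suc k) X = (\<lambda>(u, x). u + x) ` (iterated_sumset k X \<times> X)"
proof
  show "iterated_sumset (Suc k) X \<subseteq> (\<lambda>(u, x). u + x) ` (iterated_sumset k X \<times> X)"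
    by (fastforce simp: iterated_sumset_def)
  show "(\<lambda>(u, x). u + x) ` (iterated_sumset k X \<times> X) \<subseteq> iterated_sumset (Suc k) X"
  proof clarify
    fix u y assume "u \<in> iterated_sumset k X" "y \<in> X"
    then obtain x where x: "\<forall>i<k. x i \<in> X" "u = (\<Sum>i<k. x i)"
      by (auto simp: iterated_sumset_def)
    have "u + y = (\<Sum>i<Suc k. (x(k := y)) i)"
      using x by simp
    moreover have "\<forall>i<Suc k. (x(k := y)) i \<in> X"
      using x \<open>y \<in> X\<close> by (auto simp: less_Suc_eq)
    ultimately show "u + y \<in> iterated_sumset (Suc k) X"
      unfolding iterated_sumset_def by blast
  qed
qed

lemma iterated_sumset_1 [simp]: "iterated_sumset (Suc 0) X = X"
  by (force simp: iterated_sumset_Suc)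

lemma iterated_sumset_add:
  "iterated_sumset (m + l) X = (\<lambda>(u, v). u + v) ` (iterated_sumset m X \<times> iterated_sumset l X)"
proof (induction l)
  case 0
  show ?case by force
next
  case (Suc l)
  have "iterated_sumset (m + Suc l) X
      = (\<lambda>(u, x). u + x) ` ((\<lambda>(u, v). u + v) ` (iterated_sumset m X \<times> iterated_sumset l X) \<times> X)"
    using Suc by (simp add: iterated_sumset_Suc)
  also have "\<dots> = (\<lambda>(u, v). u + v) ` (iterated_sumset m X \<times> iterated_sumset (Suc l) X)"
    unfolding iterated_sumset_Suc by (force simp: add.assoc image_iff)
  finally show ?case .
qed

lemma finite_iterated_sumset [simp]: "finite X \<Longrightarrow> finite (iterated_sumset k X)"
  by (induction k) (auto simp: iterated_sumset_Suc)

lemma iterated_sumset_eq_empty_iff [simp]: "iterated_sumset k X = {} \<longleftrightarrow> X = {} \<and> k > 0"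
  by (induction k) (auto simp: iterated_sumset_Suc)

lemma iterated_sumset_mono: "X \<subseteq> Y \<Longrightarrow> iterated_sumset k X \<subseteq> iterated_sumset k Y"
  by (auto simp: iterated_sumset_def)

lemma iterated_sumset_uminus: "iterated_sumset k (uminus ` X) = uminus ` iterated_sumset k X"
proof (induction k)
  case (Suc k)
  show ?case
    unfolding iterated_sumset_Suc Suc by (force simp: image_iff)
qed simp

lemma card_le_card_plus:
  fixes X Y :: "real set"
  assumes "finite X" "finite Y" "Y \<noteq> {}"
  shows "card X \<le> card ((\<lambda>(x, y). x + y) ` (X \<times> Y))"
proof -
  obtain y where "y \<in> Y" using assms by blast
  have "card X = card ((\<lambda>x. x + y) ` X)"
    by (simp add: card_image)
  also have "\<dots> \<le> card ((\<lambda>(x, y). x + y) ` (X \<times> Y))"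
    using assms \<open>y \<in> Y\<close> by (intro card_mono) auto
  finally show ?thesis .
qed

lemma card_iterated_sumset_mono:
  assumes "finite X" "X \<noteq> {}" "k \<le> l"
  shows "card (iterated_sumset k X) \<le> card (iterated_sumset l X)"
  using \<open>k \<le> l\<close>
proof (induction rule: dec_induct)
  case (step m)
  have "card (iterated_sumset m X) \<le> card (iterated_sumset (Suc m) X)"
    using card_le_card_plus[of "iterated_sumset m X" X] assms by (simp add: iterated_sumset_Suc)
  then show ?case using step by linarith
qed simp

section \<open>Sets of the form mX - lX\<close>

definition sumset_diff :: "nat \<Rightarrow> nat \<Rightarrow> real set \<Rightarrow> real set" where
  "sumset_diff m l X = (\<lambda>(u, v). u - v) ` (iterated_sumset m X \<times> iterated_sumset l X)"

lemma sumset_diffI: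
  "u \<in> iterated_sumset m X \<Longrightarrow> v \<in> iterated_sumset l X \<Longrightarrow> u - v \<in> sumset_diff m l X"
  by (auto simp: sumset_diff_def)

lemma finite_sumset_diff [simp]: "finite X \<Longrightarrow> finite (sumset_diff m l X)"
  by (simp add: sumset_diff_def)

lemma sumset_diff_1_0 [simp]: "sumset_diff (Suc 0) 0 X = X"
  by (force simp: sumset_diff_def)

lemma sumset_diff_mono: "X \<subseteq> Y \<Longrightarrow> sumset_diff m l X \<subseteq> sumset_diff m l Y"
  unfolding sumset_diff_def using iterated_sumset_mono by blast

lemma sumset_diff_uminus: "sumset_diff m l (uminus ` X) = uminus ` sumset_diff m l X"
  unfolding sumset_diff_def iterated_sumset_uminus by (force simp: image_iff)

lemma sumset_diff_add:
  assumes "x \<in> sumset_diff m l X" "y \<in> sumset_diff m' l' X"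
  shows "x + y \<in> sumset_diff (m + m') (l + l') X"
proof -
  obtain u v u' v' where *: "u \<in> iterated_sumset m X" "v \<in> iterated_sumset l X" "x = u - v"
    "u' \<in> iterated_sumset m' X" "v' \<in> iterated_sumset l' X" "y = u' - v'"
    using assms by (auto simp: sumset_diff_def)
  then have "u + u' \<in> iterated_sumset (m + m') X" "v + v' \<in> iterated_sumset (l + l') X"
    by (auto simp: iterated_sumset_add)
  then have "(u + u') - (v + v') \<in> sumset_diff (m + m') (l + l') X"
    by (rule sumset_diffI)
  moreover have "x + y = (u + u') - (v + v')" using * by simp
  ultimately show ?thesis by metis
qed

lemma sumset_diff_flip: "x \<in> sumset_diff m l X \<Longrightarrow> - x \<in> sumset_diff l m X"
  by (force simp: sumset_diff_def)

lemma iterated_sumset_subset_sumset_diff: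
  assumes "Z \<subseteq> sumset_diff 1 1 X"
  shows "iterated_sumset m Z \<subseteq> sumset_diff m m X"
proof (induction m)
  case 0
  show ?case by (auto simp: sumset_diff_def)
next
  case (Suc m)
  have "u + x \<in> sumset_diff (Suc m) (Suc m) X" if "u \<in> iterated_sumset m Z" "x \<in> Z" for u x
    using sumset_diff_add[of u m m X x 1 1] Suc that assms by auto
  then show ?case by (auto simp: iterated_sumset_Suc)
qed

text \<open>Every element of \<open>Z\<close> costs one plus and one minus from \<open>X\<close>,
  whatever its own sign. This is why the number of summands doubles each time the squeezing is
  iterated.\<close>

lemma sumset_diff_of_sumset_diff:
  assumes "Z \<subseteq> sumset_diff 1 1 X"
  shows "sumset_diff m l Z \<subseteq> sumset_diff (m + l) (m + l) X"
proof
  fix z assume "z \<in> sumset_diff m l Z"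
  then obtain u v where "u \<in> iterated_sumset m Z" "v \<in> iterated_sumset l Z" "z = u - v"
    by (auto simp: sumset_diff_def)
  then have "u \<in> sumset_diff m m X" "- v \<in> sumset_diff l l X"
    using iterated_sumset_subset_sumset_diff[OF assms] sumset_diff_flip by blast+
  from sumset_diff_add[OF this] show "z \<in> sumset_diff (m + l) (m + l) X"
    using \<open>z = u - v\<close> by simp
qed

text \<open>Fix for each difference \<open>w\<close> one representation \<open>w = x - y\<close> and
  send \<open>(z, w)\<close> to \<open>(x + z, y + z)\<close>. The difference of the two coordinates
  recovers \<open>w\<close>, hence \<open>x\<close> and \<open>y\<close>, hence \<open>z\<close>, so
  this map is injective.\<close>

lemma ruzsa_triangle:
  fixes X Y Z :: "real set"
  assumes "finite X" "finite Y" "finite Z"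
  shows "card Z * card ((\<lambda>(x, y). x - y) ` (X \<times> Y))
    \<le> card ((\<lambda>(x, z). x + z) ` (X \<times> Z)) * card ((\<lambda>(y, z). y + z) ` (Y \<times> Z))"
proof -
  let ?D = "(\<lambda>(x, y). x - y) ` (X \<times> Y)"
  have "\<forall>w\<in>?D. \<exists>p. fst p \<in> X \<and> snd p \<in> Y \<and> w = fst p - snd p"
    by force
  then obtain p where p: "\<And>w. w \<in> ?D \<Longrightarrow> fst (p w) \<in> X \<and> snd (p w) \<in> Y \<and> w = fst (p w) - snd (p w)"
    by metis
  let ?F = "\<lambda>(z, w). (fst (p w) + z, snd (p w) + z)"
  have "inj_on ?F (Z \<times> ?D)"
  proof (rule inj_onI, clarsimp simp del: image_eqI)
    fix z z' x y x' y'
    assume "x \<in> X" "y \<in> Y" "x' \<in> X" "y' \<in> Y"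
      and eq: "fst (p (x - y)) + z = fst (p (x' - y')) + z'" "snd (p (x - y)) + z = snd (p (x' - y')) + z'"
    then have "x - y = fst (p (x - y)) - snd (p (x - y))" "x' - y' = fst (p (x' - y')) - snd (p (x' - y'))"
      using p[of "x - y"] p[of "x' - y'"] by auto
    then have "x - y = x' - y'" using eq by linarith
    then show "z = z' \<and> x - y = x' - y'" using eq by simp
  qed
  then have "card (Z \<times> ?D) = card (?F ` (Z \<times> ?D))"
    by (simp add: card_image)
  also have "\<dots> \<le> card (((\<lambda>(x, z). x + z) ` (X \<times> Z)) \<times> ((\<lambda>(y, z). y + z) ` (Y \<times> Z)))"
    using assms p by (intro card_mono finite_cartesian_product finite_imageI) fastforce+
  finally show ?thesis by (simp add: card_cartesian_product)
qed

lemma card_sumset_diff_le: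
  assumes "finite X"
  shows "card (iterated_sumset k X) * card (sumset_diff m l X)
    \<le> card (iterated_sumset (m + k) X) * card (iterated_sumset (l + k) X)"
  unfolding iterated_sumset_add sumset_diff_def using assms by (intro ruzsa_triangle) auto

section \<open>Popular gaps and squeezing\<close>

text \<open>\<open>t\<close> is the least value with at least half of \<open>I\<close> at or below
  it; \<open>L\<close> and \<open>H\<close> are the indices at or below and at or above
  \<open>t\<close>, and share those where \<phi> equals \<open>t\<close>. In \<open>squeeze\<close>
  every gap in \<open>L\<close> is then at most every gap in \<open>H\<close>, which makes room for
  insertions.\<close>

lemma median_split:
  fixes \<phi> :: "'a \<Rightarrow> 'b::linorder"
  assumes "finite I" "I \<noteq> {}"
  obtains L H where "L \<subseteq> I" "H \<subseteq> I" "card I \<le> 2 * card L" "card I \<le> 2 * card H"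
    "\<And>i j. i \<in> L \<Longrightarrow> j \<in> H \<Longrightarrow> \<phi> i \<le> \<phi> j"
proof -
  define S where "S = {t \<in> \<phi> ` I. card I \<le> 2 * card {j \<in> I. \<phi> j \<le> t}}"
  have "finite S" using assms by (simp add: S_def)
  have "{j \<in> I. \<phi> j \<le> Max (\<phi> ` I)} = I" using assms by auto
  then have "Max (\<phi> ` I) \<in> S" using assms by (simp add: S_def)
  then have "S \<noteq> {}" by blast
  define t where "t = Min S"
  have "t \<in> S" using \<open>finite S\<close> \<open>S \<noteq> {}\<close> by (simp add: t_def)
  have t_le: "t \<le> s" if "s \<in> S" for s
    using that \<open>finite S\<close> by (simp add: t_def)
  define L where "L = {j \<in> I. \<phi> j \<le> t}"
  define H where "H = {j \<in> I. t \<le> \<phi> j}"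
  have "card I \<le> 2 * card H"
  proof (rule ccontr)
    assume less: "\<not> card I \<le> 2 * card H"
    \<comment> \<open>If \<open>H\<close> were less than half, then \<open>R\<close> would be more
      than half, and its largest value would be a member of \<open>S\<close> below
      \<open>t\<close>.\<close>
    define R where "R = {j \<in> I. \<phi> j < t}"
    have "I = R \<union> H" "R \<inter> H = {}" "finite R" "finite H"
      using assms by (auto simp: R_def H_def)
    then have "card I = card R + card H"
      by (simp add: card_Un_disjoint)
    then have "card I \<le> 2 * card R" "R \<noteq> {}"
      using less by auto
    define t' where "t' = Max (\<phi> ` R)"
    have "t' \<in> \<phi> ` R" using \<open>finite R\<close> \<open>R \<noteq> {}\<close> by (simp add: t'_def)
    then have "t' < t" "t' \<in> \<phi> ` I" by (auto simp: R_def)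
    have "R \<subseteq> {j \<in> I. \<phi> j \<le> t'}"
      using \<open>finite R\<close> by (auto simp: R_def t'_def)
    then have "card R \<le> card {j \<in> I. \<phi> j \<le> t'}"
      using assms by (intro card_mono) auto
    then have "t' \<in> S"
      using \<open>t' \<in> \<phi> ` I\<close> \<open>card I \<le> 2 * card R\<close> by (simp add: S_def)
    then show False using t_le[of t'] \<open>t' < t\<close> by simp
  qed
  moreover have "card I \<le> 2 * card L"
    using \<open>t \<in> S\<close> by (simp add: S_def L_def)
  ultimately show ?thesis
    by (intro that[of L H]) (auto simp: L_def H_def)
qed

lemma strict_mono_upto_le:
  fixes b :: "nat \<Rightarrow> real"
  assumes "strict_mono_on {..q} b" "i \<le> j" "j \<le> q"
  shows "b i \<le> b j"
  using strict_mono_onD[OF assms(1), of i j] assms(2,3) by (cases "i = j") auto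

lemma gap_index_unique:
  fixes b :: "nat \<Rightarrow> real"
  assumes "strict_mono_on {..q} b"
    and "i < q" "j < q" "b i < t" "t \<le> b (Suc i)" "b j < t" "t \<le> b (Suc j)"
  shows "i = j"
proof (rule ccontr)
  assume "i \<noteq> j"
  then consider "Suc i \<le> j" | "Suc j \<le> i" by linarith
  then show False
  proof cases
    case 1
    then have "b (Suc i) \<le> b j" using assms by (intro strict_mono_upto_le[of q b]) auto
    then show False using assms by linarith
  next
    case 2
    then have "b (Suc j) \<le> b i" using assms by (intro strict_mono_upto_le[of q b]) auto
    then show False using assms by linarith
  qed
qed

text \<open>A sum \<open>b i + g j\<close> with \<open>g j \<le> g i\<close> lies above
  \<open>b i\<close> and at or below \<open>b (Suc i)\<close>, so it determines \<open>i\<close> and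
  then \<open>g j\<close>. If the gaps are unpopular, at most \<theta> pairs share a value, so the
  squared number of unpopular indices is at most \<open>2 * card T * \<theta>\<close>, which is at
  most a quarter of \<open>q ^ 2\<close>.\<close>

lemma popular_gaps:
  fixes b :: "nat \<Rightarrow> real" and q :: nat and \<theta> :: real
  defines "g \<equiv> \<lambda>i. b (Suc i) - b i"
  assumes mono: "strict_mono_on {..q} b"
    and "finite T"
    and T: "\<And>i j. i < q \<Longrightarrow> j < q \<Longrightarrow> g j \<le> g i \<Longrightarrow> b i + g j \<in> T"
    and \<theta>: "0 \<le> \<theta>" "8 * real (card T) * \<theta> \<le> real q ^ 2"
  shows "q \<le> 2 * card {i \<in> {..<q}. \<theta> \<le> card {j \<in> {..<q}. g j = g i}}"
proof -
  define U where "U = {i \<in> {..<q}. card {j \<in> {..<q}. g j = g i} < \<theta>}"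
  define W where "W = {p \<in> U \<times> U. g (snd p) \<le> g (fst p)}"
  have fin: "finite U" "finite W" by (auto simp: U_def W_def)
  have gpos: "0 < g i" if "i < q" for i
    using strict_mono_onD[OF mono, of i "Suc i"] that by (simp add: g_def)
  have "U \<times> U \<subseteq> W \<union> prod.swap ` W"
    by (auto simp: W_def image_iff)
  then have "card (U \<times> U) \<le> card (W \<union> prod.swap ` W)"
    using fin by (intro card_mono) auto
  also have "\<dots> \<le> card W + card (prod.swap ` W)" by (rule card_Un_le)
  also have "\<dots> \<le> 2 * card W" using card_image_le[of W prod.swap] fin by simp
  finally have UW: "card U * card U \<le> 2 * card W" by (simp add: card_cartesian_product)
  define F where "F = (\<lambda>t. {p \<in> W. b (fst p) + g (snd p) = t})"
  have F: "real (card (F t)) \<le> \<theta>" for t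
  proof (cases "F t = {}")
    case False
    then obtain i0 j0 where 0: "(i0, j0) \<in> F t" by auto
    have "F t \<subseteq> {i0} \<times> {j \<in> {..<q}. g j = g j0}"
    proof clarify
      fix i j assume ij: "(i, j) \<in> F t"
      have *: "i < q" "i0 < q" "j < q" "j0 < q" "b i + g j = t" "b i0 + g j0 = t" "g j \<le> g i" "g j0 \<le> g i0"
        using ij 0 by (auto simp: F_def W_def U_def)
      have "b i < t" "b i0 < t"
        using * gpos[of j] gpos[of j0] by linarith+
      moreover have "t \<le> b (Suc i)" "t \<le> b (Suc i0)"
        using *(5-8) unfolding g_def by linarith+
      ultimately have "i = i0"
        using gap_index_unique[OF mono *(1,2)] by blast
      then show "i \<in> {i0} \<and> j \<in> {j \<in> {..<q}. g j = g j0}"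
        using ij 0 by (auto simp: F_def W_def U_def)
    qed
    then have "card (F t) \<le> card ({i0} \<times> {j \<in> {..<q}. g j = g j0})"
      by (intro card_mono) auto
    also have "\<dots> = card {j \<in> {..<q}. g j = g j0}" by (simp add: card_cartesian_product)
    also have "real \<dots> \<le> \<theta>" using 0 by (auto simp: F_def W_def U_def)
    finally show ?thesis by simp
  qed (use \<theta> in simp)
  have "W = (\<Union>t\<in>T. F t)" using T by (auto simp: F_def W_def U_def)
  then have "card W \<le> (\<Sum>t\<in>T. card (F t))"
    using card_UN_le[OF \<open>finite T\<close>] by metis
  then have "real (card W) \<le> (\<Sum>t\<in>T. real (card (F t)))"
    by (metis of_nat_le_iff of_nat_sum)
  also have "\<dots> \<le> real (card T) * \<theta>" using sum_bounded_above[of T "\<lambda>t. real (card (F t))" \<theta>] F by simp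
  finally have "real (card W) \<le> real (card T) * \<theta>" .
  moreover have "real (card U * card U) \<le> real (2 * card W)" using UW by (simp only: of_nat_le_iff)
  ultimately have "real (card U) ^ 2 \<le> 2 * (real (card T) * \<theta>)"
    by (simp add: power2_eq_square)
  then have "(2 * real (card U)) ^ 2 \<le> real q ^ 2" using \<theta> by (simp add: power_mult_distrib)
  then have "2 * real (card U) \<le> real q" by (rule power2_le_imp_le) simp
  then have "2 * card U \<le> q" by linarith
  moreover have "{i \<in> {..<q}. \<theta> \<le> card {j \<in> {..<q}. g j = g i}} = {..<q} - U"
    by (auto simp: U_def)
  moreover have "U \<subseteq> {..<q}" by (auto simp: U_def)
  ultimately show ?thesis by (simp add: card_Diff_subset fin)
qed

text \<open>\<open>E\<close> consists of the popular gap lengths of \<open>b\<close>. Each popular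
  class of indices is split at the median of the gaps of \<open>y\<close> into a lower half
  \<open>L e\<close> and an upper half \<open>H e\<close>. The factor 4 is one 2 from
  \<open>popular_gaps\<close> and one from the halving.\<close>

lemma squeeze:
  fixes b y :: "nat \<Rightarrow> real" and q :: nat and \<theta> :: real
  defines "g \<equiv> \<lambda>i. b (Suc i) - b i"
  assumes mono: "strict_mono_on {..q} b"
    and "finite T"
    and T: "\<And>i j. i < q \<Longrightarrow> j < q \<Longrightarrow> g j \<le> g i \<Longrightarrow> b i + g j \<in> T"
    and \<theta>: "0 < \<theta>" "8 * real (card T) * \<theta> \<le> real q ^ 2"
  obtains E L H where "finite E" "\<And>e. e \<in> E \<Longrightarrow> 0 < e"
    "\<And>e. e \<in> E \<Longrightarrow> L e \<subseteq> {i \<in> {..<q}. g i = e}"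
    "\<And>e. e \<in> E \<Longrightarrow> H e \<subseteq> {i \<in> {..<q}. g i = e}"
    "\<And>e. e \<in> E \<Longrightarrow> \<theta> \<le> 2 * card (L e)"
    "q \<le> 4 * (\<Sum>e\<in>E. card (H e))"
    "\<And>e i j. e \<in> E \<Longrightarrow> i \<in> L e \<Longrightarrow> j \<in> H e \<Longrightarrow> y (Suc i) - y i \<le> y (Suc j) - y j"
proof -
  define C where "C = (\<lambda>e. {j \<in> {..<q}. g j = e})"
  define P where "P = {i \<in> {..<q}. \<theta> \<le> card (C (g i))}"
  define E where "E = g ` P"
  have "q \<le> 2 * card P"
    using popular_gaps[of q b T \<theta>] assms unfolding P_def C_def g_def by simp
  have gpos: "0 < g i" if "i < q" for i
    using strict_mono_onD[OF mono, of i "Suc i"] that by (simp add: g_def)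
  have C: "C e \<noteq> {}" "finite (C e)" "\<theta> \<le> card (C e)" "0 < e" if "e \<in> E" for e
    using that gpos by (auto simp: E_def C_def P_def)
  have "\<exists>L H. L \<subseteq> C e \<and> H \<subseteq> C e \<and> card (C e) \<le> 2 * card L \<and> card (C e) \<le> 2 * card H \<and>
      (\<forall>i\<in>L. \<forall>j\<in>H. y (Suc i) - y i \<le> y (Suc j) - y j)" if "e \<in> E" for e
    using median_split[OF C(2,1)[OF that], of "\<lambda>i. y (Suc i) - y i"] by metis
  then obtain L H where LH: "\<And>e. e \<in> E \<Longrightarrow> L e \<subseteq> C e \<and> H e \<subseteq> C e \<and> card (C e) \<le> 2 * card (L e)
      \<and> card (C e) \<le> 2 * card (H e) \<and> (\<forall>i\<in>L e. \<forall>j\<in>H e. y (Suc i) - y i \<le> y (Suc j) - y j)"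
    by metis
  have "finite P" "finite E" by (auto simp: P_def E_def)
  have "card P \<le> card (\<Union>e\<in>E. C e)"
    using C(2) \<open>finite E\<close> by (intro card_mono) (auto simp: E_def P_def C_def)
  also have "\<dots> \<le> (\<Sum>e\<in>E. card (C e))" by (rule card_UN_le[OF \<open>finite E\<close>])
  also have "\<dots> \<le> (\<Sum>e\<in>E. 2 * card (H e))" using LH by (intro sum_mono) auto
  finally have "q \<le> 4 * (\<Sum>e\<in>E. card (H e))"
    using \<open>q \<le> 2 * card P\<close> by (simp add: sum_distrib_left[symmetric])
  moreover have "\<theta> \<le> 2 * card (L e)" if "e \<in> E" for e
    using LH[OF that] C(3)[OF that] by linarith
  ultimately show ?thesis
    using LH C(4) \<open>finite E\<close> that[of E L H] unfolding C_def by blast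
qed

text \<open>The points \<open>y j + v\<close> are inserted into the interval after
  \<open>y j\<close>, closed on the right. These intervals are disjoint, so a point determines
  \<open>j\<close>, then \<open>e\<close> as the class of \<open>j\<close>, then
  \<open>v\<close>.\<close>

lemma squeeze_card:
  fixes y g :: "nat \<Rightarrow> real" and q :: nat
  assumes mono: "strict_mono_on {..q} y"
    and "finite E" "finite S"
    and H: "\<And>e. e \<in> E \<Longrightarrow> H e \<subseteq> {i \<in> {..<q}. g i = e}"
    and V: "\<And>e j v. e \<in> E \<Longrightarrow> j \<in> H e \<Longrightarrow> v \<in> V e \<Longrightarrow> 0 < v \<and> v \<le> y (Suc j) - y j"
    and S: "\<And>e j v. e \<in> E \<Longrightarrow> j \<in> H e \<Longrightarrow> v \<in> V e \<Longrightarrow> y j + v \<in> S"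
    and fin: "\<And>e. e \<in> E \<Longrightarrow> finite (V e)"
  shows "(\<Sum>e\<in>E. card (H e) * card (V e)) \<le> card S"
proof -
  have finH: "finite (H e)" if "e \<in> E" for e
    using H[OF that] by (rule finite_subset) auto
  let ?X = "SIGMA e:E. H e \<times> V e"
  have "(\<Sum>e\<in>E. card (H e) * card (V e)) = card ?X"
    using finH fin \<open>finite E\<close> by (simp add: card_cartesian_product)
  also have "\<dots> = card ((\<lambda>(e, j, v). y j + v) ` ?X)"
  proof (rule card_image[symmetric], rule inj_onI, clarify)
    fix e j v e' j' v'
    assume 1: "e \<in> E" "j \<in> H e" "v \<in> V e" and 2: "e' \<in> E" "j' \<in> H e'" "v' \<in> V e'"
      and eq: "y j + v = y j' + v'"
    have *: "j < q" "g j = e" "j' < q" "g j' = e'"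
      using H[OF 1(1)] H[OF 2(1)] 1 2 by auto
    have "y j < y j + v" "y j + v \<le> y (Suc j)" "y j' < y j + v" "y j + v \<le> y (Suc j')"
      using V[OF 1] V[OF 2] eq by linarith+
    then have "j = j'"
      using gap_index_unique[OF mono *(1,3)] by blast
    then show "e = e' \<and> (j, v) = (j', v')"
      using eq * by auto
  qed
  also have "\<dots> \<le> card S"
    using S \<open>finite S\<close> by (intro card_mono) auto
  finally show ?thesis .
qed

section \<open>Differences of k-convex functions\<close>

lemma ex_strict_mono_enumeration:
  fixes A :: "real set"
  assumes "finite A" "card A = Suc q"
  obtains b where "strict_mono_on {..q} b" "b ` {..q} = A"
proof
  let ?b = "(!) (sorted_list_of_set A)"
  show "strict_mono_on {..q} ?b"
    using assms by (intro strict_mono_onI sorted_wrt_nth_less[of "(<)"]) auto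
  have "A = set (sorted_list_of_set A)" using assms by simp
  also have "\<dots> = ?b ` {..<Suc q}" using assms by (auto simp: set_conv_nth)
  finally show "?b ` {..q} = A" by (simp add: lessThan_Suc_atMost)
qed

lemma k_convex_on_uminus:
  assumes "k_convex_on k J g"
  shows "k_convex_on k J (\<lambda>x. - g x)"
proof -
  obtain G where G: "G 0 = g"
    "\<And>j x. j \<le> k \<Longrightarrow> x \<in> J \<Longrightarrow> (G j has_real_derivative G (Suc j) x) (at x within J)"
    "\<And>j x. j \<in> {1..k+1} \<Longrightarrow> x \<in> J \<Longrightarrow> G j x \<noteq> 0"
    using assms unfolding k_convex_on_def by blast
  then show ?thesis
    unfolding k_convex_on_def
    by (intro exI[of _ "\<lambda>j x. - G j x"]) (auto intro!: DERIV_minus)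
qed

text \<open>For replacing \<open>f\<close> by \<open>-f\<close>: the ranges of the differences are
  reflected, and their inverses become \<open>g (- x)\<close>.\<close>

lemma k_convex_on_mirror:
  assumes "k_convex_on k J g"
  shows "k_convex_on k (uminus ` J) (\<lambda>x. g (- x))"
proof -
  obtain G where G: "G 0 = g"
    "\<And>j x. j \<le> k \<Longrightarrow> x \<in> J \<Longrightarrow> (G j has_real_derivative G (Suc j) x) (at x within J)"
    "\<And>j x. j \<in> {1..k+1} \<Longrightarrow> x \<in> J \<Longrightarrow> G j x \<noteq> 0"
    using assms unfolding k_convex_on_def by blast
  have "((\<lambda>x. (- 1) ^ j * G j (- x)) has_real_derivative (- 1) ^ Suc j * G (Suc j) (- x))
      (at x within uminus ` J)" if "j \<le> k" "x \<in> uminus ` J" for j x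
  proof -
    have "- x \<in> J" using that by auto
    have "(G j \<circ> uminus has_real_derivative G (Suc j) (- x) * - 1) (at x within uminus ` J)"
      using G(2)[OF \<open>j \<le> k\<close> \<open>- x \<in> J\<close>] by (intro DERIV_image_chain) (auto simp: image_image intro!: derivative_eq_intros)
    from DERIV_cmult[OF this, of "(- 1) ^ j"] show ?thesis by (simp add: o_def)
  qed
  moreover have "(- 1) ^ j * G j (- x) \<noteq> 0" if "j \<in> {1..k+1}" "x \<in> uminus ` J" for j x
    using G(3)[of j "- x"] that by auto
  ultimately show ?thesis
    using G(1) unfolding k_convex_on_def
    by (intro exI[of _ "\<lambda>j x. (- 1) ^ j * G j (- x)"] conjI allI impI ballI) simp_all
qed

lemma derivative_nonzero_increment:
  fixes J :: "real set"
  assumes "convex J" "x \<in> J" "y \<in> J" "x < y"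
    and deriv: "\<And>z. z \<in> J \<Longrightarrow> (h has_real_derivative h' z) (at z within J)"
    and nz: "\<And>z. z \<in> J \<Longrightarrow> h' z \<noteq> 0"
  shows "h x \<noteq> h y"
proof -
  have sub: "{x..y} \<subseteq> J"
    using assms(1-4) by (metis atLeastAtMost_subset_contains_Inf atLeastatMost_subset_iff closed_segment_eq_real_ivl closed_segment_subset less_imp_le)
  have "\<exists>z\<in>{x<..<y}. h y - h x = h' z * (y - x)"
  proof (rule mvt_simple[OF \<open>x < y\<close>])
    fix z assume "x \<le> z" "z \<le> y"
    then have "z \<in> J" using sub by auto
    then show "(h has_derivative (*) (h' z)) (at z within {x..y})"
      using DERIV_subset[OF deriv sub] by (simp add: has_field_derivative_def)
  qed
  then obtain z where "z \<in> {x<..<y}" "h y - h x = h' z * (y - x)" by blast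
  moreover from this have "h' z \<noteq> 0" using sub by (intro nz) auto
  ultimately show ?thesis using \<open>x < y\<close> by auto
qed

text \<open>For \<open>k = 0\<close> the derivative need not be continuous, so the argument goes
  through injectivity: the mean value theorem makes \<open>h\<close> injective, and a continuous
  injection on an interval is monotone.\<close>

lemma k_convex_on_strict_mono:
  assumes "k_convex_on k J h" "convex J"
  shows "strict_mono_on J h \<or> strict_mono_on J (\<lambda>x. - h x)"
proof -
  obtain G where G: "G 0 = h"
    "\<And>j x. j \<le> k \<Longrightarrow> x \<in> J \<Longrightarrow> (G j has_real_derivative G (Suc j) x) (at x within J)"
    "\<And>j x. j \<in> {1..k+1} \<Longrightarrow> x \<in> J \<Longrightarrow> G j x \<noteq> 0"
    using assms unfolding k_convex_on_def by blast
  have deriv: "(h has_real_derivative G 1 z) (at z within J)" "G 1 z \<noteq> 0" if "z \<in> J" for z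
    using G(2)[of 0 z] G(3)[of 1 z] G(1) that by auto
  have "inj_on h J"
    using derivative_nonzero_increment[OF assms(2) _ _ _ deriv] by (intro linorder_inj_onI) auto
  moreover have "continuous_on J h"
    using deriv by (intro DERIV_continuous_on)
  moreover have "is_interval J" using assms by (simp add: is_interval_convex_1)
  ultimately have "strict_mono_on J h \<or> strict_antimono_on J h"
    using injective_eq_monotone_map by blast
  then show ?thesis by (auto simp: monotone_on_def)
qed

lemma convex_shift_Int:
  fixes J :: "real set"
  assumes "convex J"
  shows "convex (J \<inter> {x. x + e \<in> J})"
proof -
  have "{x. x + e \<in> J} = (\<lambda>x. x - e) ` J" by (force simp: image_iff)
  then have "convex {x. x + e \<in> J}" using assms by simp
  then show ?thesis using assms by (simp add: convex_Int)
qed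

text \<open>The \<open>j\<close>-th derivative of the difference is the \<open>e\<close>-difference
  of the \<open>j\<close>-th derivative of \<open>h\<close>. It is nonzero by the mean value theorem
  because derivative \<open>j + 1\<close> of \<open>h\<close> is nonzero, which costs one order of
  convexity.\<close>

lemma k_convex_on_fwd_diff:
  assumes "k_convex_on (Suc k) J h" "convex J" "e > 0"
  shows "k_convex_on k (J \<inter> {x. x + e \<in> J}) (fwd_diff h e)"
proof -
  let ?K = "J \<inter> {x. x + e \<in> J}"
  obtain G where G: "G 0 = h"
    "\<And>j x. j \<le> Suc k \<Longrightarrow> x \<in> J \<Longrightarrow> (G j has_real_derivative G (Suc j) x) (at x within J)"
    "\<And>j x. j \<in> {1..Suc k+1} \<Longrightarrow> x \<in> J \<Longrightarrow> G j x \<noteq> 0"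
    using assms unfolding k_convex_on_def by blast
  have "((\<lambda>x. G j (x + e) - G j x) has_real_derivative G (Suc j) (x + e) - G (Suc j) x) (at x within ?K)"
    if "j \<le> k" "x \<in> ?K" for j x
  proof (rule DERIV_diff)
    have "e + x \<in> J" "(+) e ` ?K \<subseteq> J" using that(2) by (auto simp: add.commute)
    then have "(G j has_real_derivative G (Suc j) (e + x)) (at (e + x) within (+) e ` ?K)"
      using that(1) DERIV_subset[OF G(2)] by simp
    then have "((\<lambda>x. G j (e + x)) has_real_derivative G (Suc j) (e + x)) (at x within ?K)"
      by (rule DERIV_at_within_shift[THEN iffD1])
    then show "((\<lambda>x. G j (x + e)) has_real_derivative G (Suc j) (x + e)) (at x within ?K)"
      by (simp only: add.commute[of e])
    have "(G j has_real_derivative G (Suc j) x) (at x within J)" using that by (intro G(2)) auto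
    then show "(G j has_real_derivative G (Suc j) x) (at x within ?K)"
      by (auto intro: has_field_derivative_subset)
  qed
  moreover have "G j (x + e) - G j x \<noteq> 0" if "j \<in> {1..k+1}" "x \<in> ?K" for j x
  proof -
    have "G j x \<noteq> G j (x + e)"
    proof (rule derivative_nonzero_increment[where h = "G j" and h' = "G (Suc j)", OF \<open>convex J\<close>])
      show "(G j has_real_derivative G (Suc j) z) (at z within J)" if "z \<in> J" for z
        using G(2)[of j z] \<open>j \<in> {1..k+1}\<close> that by auto
      show "G (Suc j) z \<noteq> 0" if "z \<in> J" for z
        using G(3)[of "Suc j" z] \<open>j \<in> {1..k+1}\<close> that by auto
    qed (use that \<open>e > 0\<close> in auto)
    then show ?thesis by simp
  qed
  moreover have "(\<lambda>x. G 0 (x + e) - G 0 x) = fwd_diff h e"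
    by (simp add: G(1) fwd_diff_def fun_eq_iff)
  ultimately have "\<exists>D. D 0 = fwd_diff h e \<and>
      (\<forall>j\<le>k. \<forall>x\<in>?K. (D j has_real_derivative D (Suc j) x) (at x within ?K)) \<and>
      (\<forall>j\<in>{1..k+1}. \<forall>x\<in>?K. D j x \<noteq> 0)"
    by (intro exI[of _ "\<lambda>j x. G j (x + e) - G j x"]) blast
  then show ?thesis unfolding k_convex_on_def .
qed

section \<open>Growth of images of sets with small local doubling\<close>

text \<open>Squeezing places into a gap of \<open>y\<close> only positive values up to the length of
  that gap, so it counts only those elements of mX - lX that lie between the minimum and the maximum
  of \<open>X\<close>. The induction runs on this local part.\<close>

definition local_diff :: "nat \<Rightarrow> nat \<Rightarrow> real set \<Rightarrow> real set" where
  "local_diff m l X = sumset_diff m l X \<inter> {Min X..Max X}"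

lemma finite_local_diff [simp]: "finite X \<Longrightarrow> finite (local_diff m l X)"
  by (simp add: local_diff_def)

lemma card_local_diff_le: "finite X \<Longrightarrow> card (local_diff m l X) \<le> card (sumset_diff m l X)"
  by (auto simp: local_diff_def intro!: card_mono)

lemma subset_local_diff:
  assumes "finite X"
  shows "X \<subseteq> local_diff (Suc m) m X"
proof
  fix x assume "x \<in> X"
  then obtain u where "u \<in> iterated_sumset m X"
    using iterated_sumset_eq_empty_iff[of m X] by blast
  then have "u + x \<in> iterated_sumset (Suc m) X"
    using \<open>x \<in> X\<close> by (auto simp: iterated_sumset_Suc)
  from sumset_diffI[OF this \<open>u \<in> iterated_sumset m X\<close>]
  show "x \<in> local_diff (Suc m) m X"
    using \<open>x \<in> X\<close> assms by (simp add: local_diff_def)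
qed

lemma card_le_card_local_diff: "finite X \<Longrightarrow> card X \<le> card (local_diff (Suc m) m X)"
  by (intro card_mono subset_local_diff) auto

lemma local_diff_mono:
  assumes "X \<subseteq> Y" "X \<noteq> {}" "finite Y"
  shows "local_diff m l X \<subseteq> local_diff m l Y"
  using Min_antimono[OF assms] Max_mono[OF assms] sumset_diff_mono[OF assms(1)]
  unfolding local_diff_def by fastforce

lemma card_local_diff_uminus:
  assumes "finite X" "X \<noteq> {}"
  shows "card (local_diff m l (uminus ` X)) = card (local_diff m l X)"
proof -
  have "Min (uminus ` X) = - Max X" "Max (uminus ` X) = - Min X"
    using assms by (simp_all add: minus_Max_eq_Min minus_Min_eq_Max)
  then have "local_diff m l (uminus ` X) = uminus ` local_diff m l X"
    unfolding local_diff_def sumset_diff_uminus by (force simp: image_iff)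
  then show ?thesis by (simp add: card_image)
qed

text \<open>Provides the set \<open>T\<close> for \<open>popular_gaps\<close>: the condition on the
  gaps keeps the sum at or below \<open>b (Suc i)\<close>, hence within the range spanned by
  \<open>b\<close>.\<close>

lemma add_gap_mem_local_diff:
  fixes b :: "nat \<Rightarrow> real"
  assumes mono: "strict_mono_on {..q} b" and "i < q" "j < q" "b (Suc j) - b j \<le> b (Suc i) - b i"
  shows "b i + (b (Suc j) - b j) \<in> local_diff 2 1 (b ` {..q})"
proof -
  have mem: "b i \<in> b ` {..q}" "b (Suc i) \<in> b ` {..q}" "b j \<in> b ` {..q}" "b (Suc j) \<in> b ` {..q}"
    using assms by auto
  have "b j < b (Suc j)" using assms by (intro strict_mono_onD[OF mono]) auto
  moreover have "Min (b ` {..q}) \<le> b i" "b (Suc i) \<le> Max (b ` {..q})" using mem by auto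
  moreover have "b i + (b (Suc j) - b j) \<in> sumset_diff (1 + 1) (0 + 1) (b ` {..q})"
    by (intro sumset_diff_add) (use mem in \<open>auto intro: sumset_diffI\<close>)
  ultimately show ?thesis using assms(4) by (auto simp: local_diff_def numeral_2_eq_2)
qed

text \<open>Local differences of the gaps on \<open>L e\<close> are positive and at most any gap on
  \<open>H e\<close>, so they fit after \<open>y j\<close> for every \<open>j\<close> in
  \<open>H e\<close>. Each gap is a difference of two values of \<open>y\<close>, and
  \<open>y j\<close> itself is the one extra summand.\<close>

lemma squeeze_local_diff:
  fixes y g :: "nat \<Rightarrow> real"
  assumes ymono: "strict_mono_on {..q} y" and "finite E"
    and L: "\<And>e. e \<in> E \<Longrightarrow> L e \<subseteq> {i \<in> {..<q}. g i = e}" "\<And>e. e \<in> E \<Longrightarrow> L e \<noteq> {}"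
    and H: "\<And>e. e \<in> E \<Longrightarrow> H e \<subseteq> {i \<in> {..<q}. g i = e}"
    and LH: "\<And>e i j. e \<in> E \<Longrightarrow> i \<in> L e \<Longrightarrow> j \<in> H e \<Longrightarrow> y (Suc i) - y i \<le> y (Suc j) - y j"
  shows "(\<Sum>e\<in>E. card (H e) * card (local_diff m l ((\<lambda>i. y (Suc i) - y i) ` L e)))
    \<le> card (local_diff (Suc (m + l)) (m + l) (y ` {..q}))"
proof (rule squeeze_card[where g = g, OF ymono \<open>finite E\<close>])
  let ?D = "\<lambda>e. (\<lambda>i. y (Suc i) - y i) ` L e" and ?Y = "y ` {..q}"
  have ygap: "y i < y (Suc i)" if "i < q" for i
    using that by (intro strict_mono_onD[OF ymono]) auto
  have finL: "finite (L e)" if "e \<in> E" for e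
    using L(1)[OF that] by (rule finite_subset) auto
  show "finite (local_diff (Suc (m + l)) (m + l) ?Y)" by simp
  show "H e \<subseteq> {i \<in> {..<q}. g i = e}" if "e \<in> E" for e by (rule H[OF that])
  show "finite (local_diff m l (?D e))" if "e \<in> E" for e using finL[OF that] by simp
  show bound: "0 < v \<and> v \<le> y (Suc j) - y j" if "e \<in> E" "j \<in> H e" "v \<in> local_diff m l (?D e)" for e j v
  proof -
    have fin: "finite (?D e)" "?D e \<noteq> {}" using finL L(2) that by auto
    have "0 < Min (?D e)" using fin L(1)[OF that(1)] ygap by auto
    moreover have "Max (?D e) \<le> y (Suc j) - y j"
      using fin LH[OF that(1) _ that(2)] by auto
    ultimately show ?thesis using that(3) by (auto simp: local_diff_def)
  qed
  show "y j + v \<in> local_diff (Suc (m + l)) (m + l) ?Y"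
    if "e \<in> E" "j \<in> H e" "v \<in> local_diff m l (?D e)" for e j v
  proof -
    have "j < q" using H that by auto
    have "y (Suc i) - y i \<in> sumset_diff 1 1 ?Y" if "i < q" for i
      using that by (intro sumset_diffI) auto
    then have "?D e \<subseteq> sumset_diff 1 1 ?Y" using L(1)[OF that(1)] by auto
    from sumset_diff_of_sumset_diff[OF this, of m l]
    have "v \<in> sumset_diff (m + l) (m + l) ?Y"
      using that by (auto simp: local_diff_def)
    moreover have "y j \<in> sumset_diff 1 0 ?Y" using \<open>j < q\<close> by simp
    ultimately have "y j + v \<in> sumset_diff (1 + (m + l)) (0 + (m + l)) ?Y"
      by (intro sumset_diff_add)
    moreover have "Min ?Y \<le> y j" "y (Suc j) \<le> Max ?Y" using \<open>j < q\<close> by auto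
    ultimately show ?thesis using bound[OF that] by (auto simp: local_diff_def)
  qed
qed

text \<open>\<tau> is any upper bound for the local part of 2B - B, so that one bound serves all the
  subsets of \<open>B\<close> to which the induction passes. The exponents reached from
  \<open>growth_0\<close> are p = 2^(k+1) - 1 and t = 2^(k+1) - k - 2.\<close>

definition growth :: "nat \<Rightarrow> nat \<Rightarrow> nat \<Rightarrow> bool" where
  "growth k p t \<longleftrightarrow> (\<exists>c>0. \<forall>J h B \<tau>. convex J \<longrightarrow> k_convex_on k J h \<longrightarrow> finite B \<longrightarrow> B \<noteq> {} \<longrightarrow> B \<subseteq> J \<longrightarrow>
     real (card (local_diff 2 1 B)) \<le> \<tau> \<longrightarrow>
     c * real (card B) ^ p \<le> real (card (local_diff (2 ^ k) (2 ^ k - 1) (h ` B))) * \<tau> ^ t)"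

lemma growth_0: "growth 0 1 0"
  unfolding growth_def
proof (intro exI[of _ 1] conjI allI impI)
  fix J h B and \<tau> :: real
  assume "convex J" "k_convex_on 0 J h" "finite B" "B \<subseteq> J"
  have "inj_on h J"
    using k_convex_on_strict_mono[OF \<open>k_convex_on 0 J h\<close> \<open>convex J\<close>]
      strict_mono_on_imp_inj_on[of J h] strict_mono_on_imp_inj_on[of J "\<lambda>x. - h x"]
    unfolding inj_on_def by auto
  then have "inj_on h B" using \<open>B \<subseteq> J\<close> by (rule inj_on_subset)
  then have "card B = card (h ` B)" by (simp add: card_image)
  also have "\<dots> \<le> card (local_diff 1 0 (h ` B))"
    using card_le_card_local_diff[of "h ` B" 0] \<open>finite B\<close> by simp
  finally show "1 * real (card B) ^ 1 \<le> real (card (local_diff (2 ^ 0) (2 ^ 0 - 1) (h ` B))) * \<tau> ^ 0"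
    by simp
qed simp

text \<open>The gaps of \<open>B\<close> fall into popular classes of order at least q^2/\<tau>. On
  one class the increments of \<open>h\<close> are values of the \<open>k\<close>-convex function
  \<open>fwd_diff h e\<close>, so the hypothesis gives at least a constant times (q^2/\<tau>)^p /
  \<tau>^t local differences. Squeezing places that many into each of at least q/4 gaps, which
  yields q^(2p+1) against \<tau>^(t+p).\<close>

lemma growth_step_mono:
  assumes IH: "\<And>J h B \<tau>. convex J \<Longrightarrow> k_convex_on k J h \<Longrightarrow> finite B \<Longrightarrow> B \<noteq> {} \<Longrightarrow> B \<subseteq> J \<Longrightarrow>
      real (card (local_diff 2 1 B)) \<le> \<tau> \<Longrightarrow>
      c * real (card B) ^ p \<le> real (card (local_diff (2 ^ k) (2 ^ k - 1) (h ` B))) * \<tau> ^ t"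
    and "c > 0" "convex J" "k_convex_on (Suc k) J h" "strict_mono_on J h"
    and B: "finite B" "card B = Suc q" "0 < q" "B \<subseteq> J" "real (card (local_diff 2 1 B)) \<le> \<tau>"
  shows "c / (8 * 64 ^ p) * real (card B) ^ (2 * p + 1)
    \<le> real (card (local_diff (2 ^ Suc k) (2 ^ Suc k - 1) (h ` B))) * \<tau> ^ (t + p)"
proof -
  obtain b where b: "strict_mono_on {..q} b" "b ` {..q} = B"
    using ex_strict_mono_enumeration[OF B(1,2)] by blast
  have bB: "b i \<in> B" if "i \<le> q" for i using b(2) that by auto
  define y where "y = (\<lambda>i. h (b i))"
  have ymono: "strict_mono_on {..q} y"
    unfolding y_def using bB B(4) strict_mono_onD[OF b(1)]
    by (intro strict_mono_onI strict_mono_onD[OF \<open>strict_mono_on J h\<close>]) auto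
  define T where "T = local_diff 2 1 B"
  define S where "S = local_diff (2 ^ Suc k) (2 ^ Suc k - 1) (h ` B)"
  \<comment> \<open>The largest threshold that \<open>popular_gaps\<close> allows.\<close>
  define \<theta> where "\<theta> = real q ^ 2 / (8 * real (card T))"
  have "finite T" "finite S" using B by (simp_all add: T_def S_def)
  have "card T > 0"
    using card_le_card_local_diff[OF B(1), of 1] B(2) by (simp add: T_def numeral_2_eq_2)
  then have "\<theta> > 0" "8 * real (card T) * \<theta> \<le> real q ^ 2" "\<tau> > 0"
    using B by (auto simp: \<theta>_def T_def)
  obtain E L H where E: "finite E" "\<And>e. e \<in> E \<Longrightarrow> 0 < e"
    and L: "\<And>e. e \<in> E \<Longrightarrow> L e \<subseteq> {i \<in> {..<q}. b (Suc i) - b i = e}"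
    and H: "\<And>e. e \<in> E \<Longrightarrow> H e \<subseteq> {i \<in> {..<q}. b (Suc i) - b i = e}"
    and cardL: "\<And>e. e \<in> E \<Longrightarrow> \<theta> \<le> 2 * card (L e)"
    and cardH: "q \<le> 4 * (\<Sum>e\<in>E. card (H e))"
    and LH: "\<And>e i j. e \<in> E \<Longrightarrow> i \<in> L e \<Longrightarrow> j \<in> H e \<Longrightarrow> y (Suc i) - y i \<le> y (Suc j) - y j"
  proof (rule squeeze[OF b(1) \<open>finite T\<close> _ \<open>\<theta> > 0\<close> \<open>8 * real (card T) * \<theta> \<le> real q ^ 2\<close>, of y])
    show "b i + (b (Suc j) - b j) \<in> T" if "i < q" "j < q" "b (Suc j) - b j \<le> b (Suc i) - b i" for i j
      using add_gap_mem_local_diff[OF b(1) that] b(2) by (simp add: T_def)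
  qed (use that in blast)
  define D where "D = (\<lambda>e. fwd_diff h e ` b ` L e)"
  define V where "V = (\<lambda>e. local_diff (2 ^ k) (2 ^ k - 1) (D e))"
  have D_eq: "D e = (\<lambda>i. y (Suc i) - y i) ` L e" if "e \<in> E" for e
    unfolding D_def image_image fwd_diff_def y_def
    using L[OF that] by (intro image_cong) auto
  have finL: "finite (L e)" if "e \<in> E" for e
    using L[OF that] by (rule finite_subset) auto
  have neL: "L e \<noteq> {}" if "e \<in> E" for e
    using cardL[OF that] \<open>\<theta> > 0\<close> by auto
  have sum_le: "(\<Sum>e\<in>E. card (H e) * card (V e)) \<le> card S"
  proof -
    \<comment> \<open>Squeezing turns \<open>m = 2 ^ k\<close> and \<open>l = 2 ^ k - 1\<close> into
      \<open>m + l + 1 = 2 ^ Suc k\<close> and \<open>m + l\<close>.\<close>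
    have "(2 ^ Suc k :: nat) = Suc (2 ^ k + (2 ^ k - 1))" "(2 ^ Suc k - 1 :: nat) = 2 ^ k + (2 ^ k - 1)"
      by (simp_all add: mult_2)
    moreover have "h ` B = y ` {..q}" using b(2) by (auto simp: y_def)
    ultimately have S_eq: "S = local_diff (Suc (2 ^ k + (2 ^ k - 1))) (2 ^ k + (2 ^ k - 1)) (y ` {..q})"
      by (simp only: S_def)
    have "(\<Sum>e\<in>E. card (H e) * card (V e))
        = (\<Sum>e\<in>E. card (H e) * card (local_diff (2 ^ k) (2 ^ k - 1) ((\<lambda>i. y (Suc i) - y i) ` L e)))"
      by (intro sum.cong) (auto simp: V_def D_eq)
    also have "\<dots> \<le> card S"
      unfolding S_eq by (rule squeeze_local_diff[OF ymono \<open>finite E\<close> L neL H LH])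
    finally show ?thesis .
  qed
  have V_large: "c * (\<theta> / 2) ^ p \<le> card (V e) * \<tau> ^ t" if "e \<in> E" for e
  proof -
    have sub: "b ` L e \<subseteq> B" using L[OF that] bB by auto
    have shift: "b i + e \<in> B" if "i \<in> L e" for i
      using L[OF \<open>e \<in> E\<close>] that bB[of "Suc i"] by auto
    \<comment> \<open>The local part is monotone in the set, so \<tau> still bounds it for the
      points indexed by \<open>L e\<close>.\<close>
    have "card (local_diff 2 1 (b ` L e)) \<le> card T"
      unfolding T_def using sub neL[OF that] B(1) by (intro card_mono local_diff_mono) auto
    then have "real (card (local_diff 2 1 (b ` L e))) \<le> \<tau>" using B(5) by (simp add: T_def)
    moreover have "b ` L e \<subseteq> J \<inter> {x. x + e \<in> J}" using sub shift B(4) by auto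
    ultimately have "c * real (card (b ` L e)) ^ p \<le> card (V e) * \<tau> ^ t"
      unfolding V_def D_def using finL[OF that] neL[OF that]
      by (intro IH[of "J \<inter> {x. x + e \<in> J}"] convex_shift_Int k_convex_on_fwd_diff E assms that) auto
    moreover have "inj_on b (L e)"
      using L[OF that] by (intro inj_on_subset[OF strict_mono_on_imp_inj_on[OF b(1)]]) auto
    ultimately have "c * real (card (L e)) ^ p \<le> card (V e) * \<tau> ^ t" by (simp add: card_image)
    moreover have "c * (\<theta> / 2) ^ p \<le> c * real (card (L e)) ^ p"
      using cardL[OF that] \<open>\<theta> > 0\<close> \<open>c > 0\<close> by (intro mult_left_mono power_mono) auto
    ultimately show ?thesis by linarith
  qed
  have "real (\<Sum>e\<in>E. card (H e)) * (c * (\<theta> / 2) ^ p) \<le> real (card S) * \<tau> ^ t"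
  proof -
    have "real (\<Sum>e\<in>E. card (H e)) * (c * (\<theta> / 2) ^ p) = (\<Sum>e\<in>E. real (card (H e)) * (c * (\<theta> / 2) ^ p))"
      by (simp add: sum_distrib_right)
    also have "\<dots> \<le> (\<Sum>e\<in>E. real (card (H e)) * (card (V e) * \<tau> ^ t))"
      using V_large by (intro sum_mono mult_left_mono) auto
    also have "\<dots> = real (\<Sum>e\<in>E. card (H e) * card (V e)) * \<tau> ^ t"
      by (simp add: sum_distrib_right mult.assoc)
    also have "\<dots> \<le> real (card S) * \<tau> ^ t"
      using \<open>\<tau> > 0\<close> by (intro mult_right_mono of_nat_mono sum_le) simp
    finally show ?thesis .
  qed
  moreover have "real q / 4 * (c * (\<theta> / 2) ^ p) \<le> real (\<Sum>e\<in>E. card (H e)) * (c * (\<theta> / 2) ^ p)"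
    using of_nat_mono[OF cardH, where 'a = real] \<open>\<theta> > 0\<close> \<open>c > 0\<close>
    by (intro mult_right_mono) auto
  moreover have "real q / 4 * (c * (real q ^ 2 / (16 * \<tau>)) ^ p) \<le> real q / 4 * (c * (\<theta> / 2) ^ p)"
  proof (intro mult_left_mono power_mono)
    show "real q ^ 2 / (16 * \<tau>) \<le> \<theta> / 2"
      using \<open>card T > 0\<close> B(5) by (auto simp: \<theta>_def T_def intro!: divide_left_mono)
  qed (use \<open>\<tau> > 0\<close> \<open>c > 0\<close> in auto)
  ultimately have "real q / 4 * (c * (real q ^ 2 / (16 * \<tau>)) ^ p) \<le> real (card S) * \<tau> ^ t"
    by linarith
  then have "real q / 4 * (c * (real q ^ 2 / (16 * \<tau>)) ^ p) * \<tau> ^ p \<le> real (card S) * \<tau> ^ t * \<tau> ^ p"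
    using \<open>\<tau> > 0\<close> by (intro mult_right_mono) auto
  also have "real q / 4 * (c * (real q ^ 2 / (16 * \<tau>)) ^ p) * \<tau> ^ p = c / (4 * 16 ^ p) * real q ^ (2 * p + 1)"
  proof -
    have "(real q ^ 2) ^ p = real q ^ (2 * p)" by (simp add: power_mult)
    then show ?thesis using \<open>\<tau> > 0\<close> by (simp add: power_divide power_mult_distrib)
  qed
  finally have main: "c / (4 * 16 ^ p) * real q ^ (2 * p + 1) \<le> real (card S) * \<tau> ^ (t + p)"
    by (simp add: power_add mult.assoc)
  \<comment> \<open>Passing from \<open>q\<close> to \<open>card B = q + 1\<close>, at most
    \<open>2 * q\<close>, costs the factor \<open>2 * 4 ^ p\<close>.\<close>
  have "c / (8 * 64 ^ p) * real (card B) ^ (2 * p + 1) \<le> c / (8 * 64 ^ p) * (2 * real q) ^ (2 * p + 1)"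
    using B(2,3) \<open>c > 0\<close> by (intro mult_left_mono power_mono) auto
  also have "\<dots> = c / (4 * 16 ^ p) * real q ^ (2 * p + 1)"
  proof -
    have "(64::real) ^ p = 16 ^ p * 4 ^ p" by (simp flip: power_mult_distrib)
    moreover have "(2::real) ^ (2 * p) = 4 ^ p" by (simp add: power_mult)
    ultimately show ?thesis by (simp add: power_mult_distrib)
  qed
  finally show ?thesis using main by (simp add: S_def)
qed

text \<open>A single point has no gaps and is covered by \<open>c' \<le> 1\<close>. A decreasing
  \<open>h\<close> is replaced by its negative, which leaves the size of the local part
  unchanged.\<close>

lemma growth_Suc:
  assumes "growth k p t"
  shows "growth (Suc k) (2 * p + 1) (t + p)"
proof -
  obtain c where "c > 0" and IH: "\<And>J h B \<tau>. convex J \<Longrightarrow> k_convex_on k J h \<Longrightarrow> finite B \<Longrightarrow> B \<noteq> {} \<Longrightarrow> B \<subseteq> J \<Longrightarrow>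
      real (card (local_diff 2 1 B)) \<le> \<tau> \<Longrightarrow>
      c * real (card B) ^ p \<le> real (card (local_diff (2 ^ k) (2 ^ k - 1) (h ` B))) * \<tau> ^ t"
    using assms unfolding growth_def by blast
  define c' where "c' = min 1 (c / (8 * 64 ^ p))"
  have "c' * real (card B) ^ (2 * p + 1)
      \<le> real (card (local_diff (2 ^ Suc k) (2 ^ Suc k - 1) (h ` B))) * \<tau> ^ (t + p)"
    if *: "convex J" "k_convex_on (Suc k) J h" "finite B" "B \<noteq> {}" "B \<subseteq> J" "real (card (local_diff 2 1 B)) \<le> \<tau>"
    for J h B \<tau>
  proof (cases "card B = 1")
    case True
    have S: "1 \<le> card (local_diff (2 ^ Suc k) (2 ^ Suc k - 1) (h ` B))"
    proof -
      have "1 \<le> card (h ` B)" using * by (simp add: Suc_leI card_gt_0_iff)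
      also have "\<dots> \<le> card (local_diff (Suc (2 ^ Suc k - 1)) (2 ^ Suc k - 1) (h ` B))"
        using * by (intro card_le_card_local_diff) auto
      finally show ?thesis by simp
    qed
    have "1 \<le> \<tau>"
      using card_le_card_local_diff[OF *(3), of 1] True *(6) by (simp add: numeral_2_eq_2)
    then have "1 * 1 \<le> real (card (local_diff (2 ^ Suc k) (2 ^ Suc k - 1) (h ` B))) * \<tau> ^ (t + p)"
      using S by (intro mult_mono one_le_power) auto
    then show ?thesis using True by (simp add: c'_def)
  next
    case False
    moreover have "card B > 0" using * by (simp add: card_gt_0_iff)
    ultimately obtain q where q: "card B = Suc q" "0 < q" by (metis One_nat_def gr0_conv_Suc gr0I)
    have "c / (8 * 64 ^ p) * real (card B) ^ (2 * p + 1)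
        \<le> real (card (local_diff (2 ^ Suc k) (2 ^ Suc k - 1) (h ` B))) * \<tau> ^ (t + p)"
    proof (cases "strict_mono_on J h")
      case True
      show ?thesis
        by (rule growth_step_mono[OF IH \<open>c > 0\<close> *(1,2) True *(3) q *(5,6)])
    next
      case False
      then have mono: "strict_mono_on J (\<lambda>x. - h x)"
        using k_convex_on_strict_mono[OF *(2,1)] by blast
      have img: "(\<lambda>x. - h x) ` B = uminus ` h ` B" by (simp add: image_image)
      have "c / (8 * 64 ^ p) * real (card B) ^ (2 * p + 1)
        \<le> real (card (local_diff (2 ^ Suc k) (2 ^ Suc k - 1) ((\<lambda>x. - h x) ` B))) * \<tau> ^ (t + p)"
        by (rule growth_step_mono[OF IH \<open>c > 0\<close> *(1) k_convex_on_uminus[OF *(2)] mono *(3) q *(5,6)])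
      then show ?thesis
        unfolding img using * by (subst (asm) card_local_diff_uminus) auto
    qed
    moreover have "c' * real (card B) ^ (2 * p + 1) \<le> c / (8 * 64 ^ p) * real (card B) ^ (2 * p + 1)"
      by (intro mult_right_mono) (auto simp: c'_def)
    ultimately show ?thesis by linarith
  qed
  moreover have "c' > 0" using \<open>c > 0\<close> by (simp add: c'_def)
  ultimately show ?thesis unfolding growth_def by blast
qed

text \<open>The pair (p, t) runs through (1, 0), (3, 1), (7, 4), (15, 11).\<close>

lemma growth_3: "growth 3 15 11"
  using growth_Suc[of 0 1 0] growth_Suc[of 1 3 1] growth_Suc[of 2 7 4] growth_0
  by (simp add: numeral_2_eq_2[symmetric] numeral_3_eq_3[symmetric])

section \<open>Incidences in a grid\<close>

lemma card_jumps_le: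
  fixes \<sigma> :: "nat \<Rightarrow> nat"
  assumes "\<And>i. i < q \<Longrightarrow> \<sigma> i \<le> \<sigma> (Suc i)"
  shows "\<sigma> 0 + card {i \<in> {..<q}. \<sigma> (Suc i) \<noteq> \<sigma> i} \<le> \<sigma> q"
  using assms
proof (induction q)
  case (Suc q)
  have IH: "\<sigma> 0 + card {i \<in> {..<q}. \<sigma> (Suc i) \<noteq> \<sigma> i} \<le> \<sigma> q"
    using Suc by simp
  have "{i \<in> {..<Suc q}. \<sigma> (Suc i) \<noteq> \<sigma> i}
      = {i \<in> {..<q}. \<sigma> (Suc i) \<noteq> \<sigma> i} \<union> (if \<sigma> (Suc q) = \<sigma> q then {} else {q})"
    by (auto simp: less_Suc_eq)
  then show ?case using IH Suc.prems[of q] by (auto simp: card_Un_disjoint)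
qed simp

text \<open>The rank of \<open>z\<close> in \<open>P\<close> divided by \<open>s\<close>:
  \<open>P\<close> is cut in increasing order into blocks of \<open>s\<close> consecutive elements,
  numbered from 0.\<close>

definition block :: "nat \<Rightarrow> real set \<Rightarrow> real \<Rightarrow> nat" where
  "block s P z = card {w \<in> P. w < z} div s"

lemma block_mono: "finite P \<Longrightarrow> z \<le> z' \<Longrightarrow> block s P z \<le> block s P z'"
  unfolding block_def by (intro div_le_mono card_mono) auto

lemma block_less:
  assumes "finite P" "z \<in> P" "m * card P < s * n"
  shows "m * block s P z < n"
proof -
  have "{w \<in> P. w < z} \<subset> P" using assms by auto
  then have "card {w \<in> P. w < z} < card P" using assms by (intro psubset_card_mono)
  then have "s * block s P z < card P"
    unfolding block_def by (rule le_less_trans[OF times_div_less_eq_dividend])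
  then have "m * (s * block s P z) \<le> m * card P" by (intro mult_le_mono2) simp
  then have "s * (m * block s P z) < s * n"
    using assms(3) unfolding mult.left_commute[of s m] by (rule le_less_trans)
  then show ?thesis by (rule mult_left_less_imp_less) simp
qed

text \<open>Distinct elements have distinct ranks, and the ranks in one block lie among
  \<open>s\<close> consecutive integers, so each element has at most \<open>s\<close> partners,
  itself included.\<close>

lemma card_same_block_le:
  assumes "finite P" "s > 0"
  shows "card {p \<in> P \<times> P. block s P (fst p) = block s P (snd p)} \<le> card P * s"
proof -
  have 1: "card {w \<in> P. block s P w = k} \<le> s" for k
  proof -
    let ?r = "\<lambda>z. card {w \<in> P. w < z}"
    have "inj_on ?r P"
    proof (rule linorder_inj_onI)
      fix x y assume "x < y" "x \<in> P" "y \<in> P"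
      then have "{w \<in> P. w < x} \<subset> {w \<in> P. w < y}" by auto
      then have "?r x < ?r y" using assms by (intro psubset_card_mono) auto
      then show "?r x \<noteq> ?r y" by simp
    qed auto
    then have "card {w \<in> P. block s P w = k} = card (?r ` {w \<in> P. block s P w = k})"
      by (intro card_image[symmetric]) (auto intro: inj_on_subset)
    also have "\<dots> \<le> card {s * k..<s * k + s}"
      using dividend_less_times_div[OF \<open>s > 0\<close>]
      by (intro card_mono) (auto simp: block_def add.commute)
    finally show ?thesis by simp
  qed
  have "{p \<in> P \<times> P. block s P (fst p) = block s P (snd p)}
      = (SIGMA z:P. {w \<in> P. block s P w = block s P z})" by auto
  then have "card {p \<in> P \<times> P. block s P (fst p) = block s P (snd p)}
      = (\<Sum>z\<in>P. card {w \<in> P. block s P w = block s P z})"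
    using assms by simp
  also have "\<dots> \<le> card P * s" using sum_bounded_above[of P _ s] 1 by simp
  finally show ?thesis .
qed

text \<open>A Szemeredi-Trotter type bound for the translates of the points
  \<open>(x i, y i)\<close> by \<open>X\<close> times \<open>Y\<close>, all inside the grid
  \<open>P\<close> times \<open>Q\<close>. The grid is cut into cells of at most \<open>s\<close>
  times \<open>t\<close> points. A translate is increasing, so at least half of its consecutive
  pairs stay within one cell. Such a pair determines the translate and the position on it, so the
  pairs of grid points in a common cell number at least \<open>q / 2\<close> times the number of
  translates.\<close>

lemma grid_incidence:
  fixes x y :: "nat \<Rightarrow> real"
  assumes x: "strict_mono_on {..q} x" and y: "strict_mono_on {..q} y" and "0 < q"
    and inj: "\<And>i j. i < q \<Longrightarrow> j < q \<Longrightarrow> x (Suc i) - x i = x (Suc j) - x j \<Longrightarrow>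
      y (Suc i) - y i = y (Suc j) - y j \<Longrightarrow> i = j"
    and fin: "finite P" "finite Q" "X \<noteq> {}" "Y \<noteq> {}"
    and P: "\<And>i u. i \<le> q \<Longrightarrow> u \<in> X \<Longrightarrow> x i + u \<in> P"
    and Q: "\<And>i v. i \<le> q \<Longrightarrow> v \<in> Y \<Longrightarrow> y i + v \<in> Q"
  shows "card X * card Y * Suc q ^ 3 \<le> 100 * (card P * card Q) ^ 2"
proof -
  have block_size: "\<exists>s>0. 4 * card R < s * Suc q \<and> Suc q * s \<le> 5 * card R"
    if "finite R" "strict_mono_on {..q} z" "\<And>i. i \<le> q \<Longrightarrow> z i + w \<in> R"
    for R :: "real set" and z :: "nat \<Rightarrow> real" and w
  \<comment> \<open>Blocks of about \<open>4 * card R / n\<close> elements, where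
    \<open>n = Suc q\<close>, keep the block numbers below \<open>n / 4\<close>. Adding 1 makes the
    size positive and the inequality strict; its cost is absorbed because the \<open>n\<close>
    distinct points \<open>z i + w\<close> lie in \<open>R\<close>.\<close>
  proof (intro exI[of _ "4 * card R div Suc q + 1"] conjI)
    have "inj_on (\<lambda>i. z i + w) {..q}"
      using strict_mono_on_imp_inj_on[OF that(2)] by (auto simp: inj_on_def)
    from card_inj_on_le[OF this, of R] have "Suc q \<le> card R" using that by auto
    moreover have "Suc q * (4 * card R div Suc q) \<le> 4 * card R"
      by (rule times_div_less_eq_dividend)
    ultimately have "Suc q * (4 * card R div Suc q) + Suc q \<le> 4 * card R + card R"
      by (intro add_mono)
    then show "Suc q * (4 * card R div Suc q + 1) \<le> 5 * card R"
      unfolding distrib_left mult_1_right by (rule order_trans) simp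
    show "4 * card R < (4 * card R div Suc q + 1) * Suc q"
      using dividend_less_div_times[of "Suc q" "4 * card R"] by simp
  qed simp
  obtain u0 v0 where "u0 \<in> X" "v0 \<in> Y" using fin by blast
  obtain s where s: "s > 0" "4 * card P < s * Suc q" "Suc q * s \<le> 5 * card P"
    using block_size[OF fin(1) x, of u0] P \<open>u0 \<in> X\<close> by blast
  obtain t where t: "t > 0" "4 * card Q < t * Suc q" "Suc q * t \<le> 5 * card Q"
    using block_size[OF fin(2) y, of v0] Q \<open>v0 \<in> Y\<close> by blast
  define PP where "PP = {p \<in> P \<times> P. block s P (fst p) = block s P (snd p)}"
  define QQ where "QQ = {p \<in> Q \<times> Q. block t Q (fst p) = block t Q (snd p)}"
  define G where "G = (\<lambda>(u, v). {i \<in> {..<q}. block s P (x (Suc i) + u) = block s P (x i + u) \<and>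
      block t Q (y (Suc i) + v) = block t Q (y i + v)})"
  have G: "q \<le> 2 * card (G (u, v))" if "u \<in> X" "v \<in> Y" for u v
  proof -
    \<comment> \<open>Both block numbers are nondecreasing along the translate, so every change of
      cell raises their sum. Each is at most \<open>q / 4\<close>, so there are at most
      \<open>q / 2\<close> changes.\<close>
    define \<sigma> where "\<sigma> = (\<lambda>i. block s P (x i + u) + block t Q (y i + v))"
    have mono: "block s P (x i + u) \<le> block s P (x (Suc i) + u)"
      "block t Q (y i + v) \<le> block t Q (y (Suc i) + v)" if "i < q" for i
      using that strict_mono_onD[OF x, of i "Suc i"] strict_mono_onD[OF y, of i "Suc i"] fin
      by (auto intro!: block_mono)
    have "\<sigma> 0 + card {i \<in> {..<q}. \<sigma> (Suc i) \<noteq> \<sigma> i} \<le> \<sigma> q"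
      by (rule card_jumps_le) (use mono in \<open>auto simp: \<sigma>_def intro: add_mono\<close>)
    moreover have "4 * block s P (x q + u) < Suc q" "4 * block t Q (y q + v) < Suc q"
      using fin P Q that s t by (auto intro!: block_less)
    ultimately have "2 * card {i \<in> {..<q}. \<sigma> (Suc i) \<noteq> \<sigma> i} \<le> q" by (simp add: \<sigma>_def)
    moreover have "{..<q} \<subseteq> {i \<in> {..<q}. \<sigma> (Suc i) \<noteq> \<sigma> i} \<union> G (u, v)"
      using mono by (force simp: G_def \<sigma>_def)
    then have "card {..<q} \<le> card {i \<in> {..<q}. \<sigma> (Suc i) \<noteq> \<sigma> i} + card (G (u, v))"
      by (intro order_trans[OF card_mono card_Un_le]) (auto simp: G_def)
    ultimately show ?thesis by simp
  qed
  have "finite X" "finite Y"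
  proof -
    have "(\<lambda>u. x 0 + u) ` X \<subseteq> P" "(\<lambda>v. y 0 + v) ` Y \<subseteq> Q" using P Q by auto
    then have "finite ((\<lambda>u. x 0 + u) ` X)" "finite ((\<lambda>v. y 0 + v) ` Y)"
      using fin finite_subset by blast+
    then show "finite X" "finite Y" by (auto dest: finite_imageD)
  qed
  have finG: "finite (G w)" for w by (auto simp: G_def split: prod.split)
  \<comment> \<open>A consecutive pair of points, stored as a pair of abscissas and a pair of
    ordinates. Equal pairs have equal increments, so \<open>inj\<close> gives the same
    \<open>i\<close>, and then \<open>u\<close> and \<open>v\<close> agree.\<close>
  define F where "F = (\<lambda>((u, v), i). ((x i + u, x (Suc i) + u), (y i + v, y (Suc i) + v)))"
  have "inj_on F (SIGMA w:X \<times> Y. G w)"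
  proof (rule inj_onI, clarify)
    fix u v i u' v' i'
    assume "i \<in> G (u, v)" "i' \<in> G (u', v')" and eq: "F ((u, v), i) = F ((u', v'), i')"
    then have "i < q" "i' < q" by (auto simp: G_def)
    have eqs: "x i + u = x i' + u'" "x (Suc i) + u = x (Suc i') + u'"
      "y i + v = y i' + v'" "y (Suc i) + v = y (Suc i') + v'"
      using eq by (auto simp: F_def)
    then have "i = i'"
      using \<open>i < q\<close> \<open>i' < q\<close> by (intro inj) auto
    then show "(u, v) = (u', v') \<and> i = i'" using eqs by auto
  qed
  moreover have "F ` (SIGMA w:X \<times> Y. G w) \<subseteq> PP \<times> QQ"
    using P Q by (auto simp: F_def G_def PP_def QQ_def)
  moreover have finPQ: "finite (PP \<times> QQ)" using fin by (simp add: PP_def QQ_def)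
  ultimately have "card (SIGMA w:X \<times> Y. G w) \<le> card (PP \<times> QQ)"
    by (rule card_inj_on_le)
  moreover have "card (PP \<times> QQ) \<le> (card P * s) * (card Q * t)"
    unfolding card_cartesian_product PP_def QQ_def
    using fin s t by (intro mult_le_mono card_same_block_le)
  moreover have "card X * card Y * q \<le> 2 * card (SIGMA w:X \<times> Y. G w)"
  proof -
    have "card X * card Y * q = (\<Sum>w\<in>X \<times> Y. q)" by (simp add: card_cartesian_product)
    also have "\<dots> \<le> (\<Sum>w\<in>X \<times> Y. 2 * card (G w))" using G by (intro sum_mono) auto
    also have "\<dots> = 2 * card (SIGMA w:X \<times> Y. G w)"
      using \<open>finite X\<close> \<open>finite Y\<close> finG by (simp add: sum_distrib_left)
    finally show ?thesis .
  qed
  ultimately have main: "card X * card Y * q \<le> 2 * ((card P * s) * (card Q * t))" by linarith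
  have regroup: "2 * (2 * ((a * s) * (b * t))) * n ^ 2 = 4 * (a * b) * ((n * s) * (n * t))" for a b n :: nat
    by (simp add: power2_eq_square mult_ac)
  \<comment> \<open>Of the three factors \<open>Suc q\<close> one is replaced by
    \<open>2 * q\<close>; the other two absorb the block sizes, as
    \<open>Suc q * s \<le> 5 * card P\<close> and likewise for \<open>t\<close>. The constant is 2 *
    2 * 25.\<close>
  have "Suc q ^ 3 = Suc q * Suc q ^ 2" by (simp only: power3_eq_cube power2_eq_square mult.assoc)
  also have "\<dots> \<le> 2 * q * Suc q ^ 2" using \<open>0 < q\<close> by (intro mult_le_mono1) simp
  finally have "card X * card Y * Suc q ^ 3 \<le> card X * card Y * (2 * q * Suc q ^ 2)"
    by (rule mult_le_mono2)
  also have "\<dots> = card X * card Y * (2 * q) * Suc q ^ 2" by (simp only: mult.assoc)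
  also have "card X * card Y * (2 * q) = 2 * (card X * card Y * q)" by (rule mult.left_commute)
  also have "\<dots> * Suc q ^ 2 \<le> 2 * (2 * ((card P * s) * (card Q * t))) * Suc q ^ 2"
    by (rule mult_le_mono1[OF mult_le_mono2[OF main]])
  also have "\<dots> = 4 * (card P * card Q) * ((Suc q * s) * (Suc q * t))"
    by (rule regroup)
  also have "\<dots> \<le> 4 * (card P * card Q) * ((5 * card P) * (5 * card Q))"
    by (intro mult_le_mono2 mult_le_mono[OF s(3) t(3)])
  also have "\<dots> = 100 * (card P * card Q) ^ 2" by (simp add: power2_eq_square)
  finally show ?thesis .
qed

section \<open>Convex functions with 3-convex inverse differences\<close>

text \<open>Stated with an arbitrary left inverse on a convex superset of the range, so that it passes to \<open>-f\<close>.\<close>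

definition convex_inverse_differences :: "real set \<Rightarrow> (real \<Rightarrow> real) \<Rightarrow> bool" where
  "convex_inverse_differences I f \<longleftrightarrow> (\<forall>d>0. \<exists>J g. convex J \<and> k_convex_on 3 J g \<and>
     (\<forall>x\<in>I. fwd_diff f d x \<in> J \<and> g (fwd_diff f d x) = x))"

lemma convex_inverse_differences_uminus:
  assumes "convex_inverse_differences I f"
  shows "convex_inverse_differences I (\<lambda>x. - f x)"
  unfolding convex_inverse_differences_def
proof (intro allI impI)
  fix d :: real assume "d > 0"
  then obtain J g where *: "convex J" "k_convex_on 3 J g"
    "\<And>x. x \<in> I \<Longrightarrow> fwd_diff f d x \<in> J \<and> g (fwd_diff f d x) = x"
    using assms unfolding convex_inverse_differences_def by metis
  moreover have "fwd_diff (\<lambda>x. - f x) d x = - fwd_diff f d x" for x by (simp add: fwd_diff_def)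
  ultimately show "\<exists>J g. convex J \<and> k_convex_on 3 J g \<and>
      (\<forall>x\<in>I. fwd_diff (\<lambda>x. - f x) d x \<in> J \<and> g (fwd_diff (\<lambda>x. - f x) d x) = x)"
    by (intro exI[of _ "uminus ` J"] exI[of _ "\<lambda>x. g (- x)"] conjI k_convex_on_mirror)
      (auto simp: convex_negations)
qed

text \<open>Grid incidences for the points \<open>(x i, f (x i))\<close>, translated by kA times
  kf(A). Two steps with the same gap \<open>d\<close> and the same increment of \<open>f\<close>
  would give \<open>fwd_diff f d\<close> one value at two points, which its left inverse
  excludes.\<close>

lemma sumset_growth:
  assumes f: "convex_inverse_differences I f"
    and A: "finite A" "A \<subseteq> I" "strict_mono_on A f" "card A = Suc q" "0 < q"
  shows "real (card (iterated_sumset k A) * card (iterated_sumset k (f ` A))) * real (Suc q) ^ 3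
    \<le> 100 * real (card (iterated_sumset (Suc k) A) * card (iterated_sumset (Suc k) (f ` A))) ^ 2"
proof -
  obtain x where x: "strict_mono_on {..q} x" "x ` {..q} = A"
    using ex_strict_mono_enumeration[OF A(1,4)] by blast
  have xA: "x i \<in> A" if "i \<le> q" for i using x(2) that by auto
  have y: "strict_mono_on {..q} (\<lambda>i. f (x i))"
    using xA strict_mono_onD[OF x(1)] by (intro strict_mono_onI strict_mono_onD[OF A(3)]) auto
  have "card (iterated_sumset k A) * card (iterated_sumset k (f ` A)) * Suc q ^ 3
    \<le> 100 * (card (iterated_sumset (Suc k) A) * card (iterated_sumset (Suc k) (f ` A))) ^ 2"
  proof (rule grid_incidence[OF x(1) y \<open>0 < q\<close>])
    fix i j assume ij: "i < q" "j < q" and dx: "x (Suc i) - x i = x (Suc j) - x j"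
      and dy: "f (x (Suc i)) - f (x i) = f (x (Suc j)) - f (x j)"
    define d where "d = x (Suc i) - x i"
    have "d > 0" using strict_mono_onD[OF x(1), of i "Suc i"] ij by (simp add: d_def)
    then obtain g where "\<And>x. x \<in> I \<Longrightarrow> g (fwd_diff f d x) = x"
      using f unfolding convex_inverse_differences_def by metis
    moreover have "fwd_diff f d (x i) = fwd_diff f d (x j)"
    proof -
      have "x i + d = x (Suc i)" "x j + d = x (Suc j)" using dx by (simp_all add: d_def)
      then show ?thesis using dy by (simp add: fwd_diff_def)
    qed
    ultimately have "x i = x j" using xA[of i] xA[of j] ij A(2) by (metis less_imp_le subsetD)
    then show "i = j" using strict_mono_on_imp_inj_on[OF x(1)] ij by (auto simp: inj_on_def)
  next
    show "x i + u \<in> iterated_sumset (Suc k) A" if "i \<le> q" "u \<in> iterated_sumset k A" for i u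
      using xA that by (force simp: iterated_sumset_Suc add.commute)
    show "f (x i) + u \<in> iterated_sumset (Suc k) (f ` A)"
      if "i \<le> q" "u \<in> iterated_sumset k (f ` A)" for i u
      using xA that by (force simp: iterated_sumset_Suc add.commute)
  qed (use A in auto)
  then show ?thesis by (metis of_nat_le_iff of_nat_mult of_nat_numeral of_nat_power)
qed

text \<open>With \<beta>(k) = |kA| |kf(A)|, \<open>sumset_growth\<close> reads \<beta>(k) n^3 \<le>
  100 \<beta>(k+1)^2, and \<beta>(1) = n^2. Iteration gives \<beta>(k+1) of order at least n^(3 -
  1/2^k), stated here without roots.\<close>

lemma sumset_lower_bound:
  assumes f: "convex_inverse_differences I f"
    and A: "finite A" "A \<subseteq> I" "strict_mono_on A f" "card A = Suc q" "0 < q"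
  shows "real (Suc q) ^ (3 * (2 ^ k - 1) + 2)
    \<le> 100 ^ (2 ^ k - 1) * real (card (iterated_sumset (Suc k) A) * card (iterated_sumset (Suc k) (f ` A))) ^ 2 ^ k"
proof (induction k)
  case 0
  have "card (f ` A) = card A"
    using strict_mono_on_imp_inj_on[OF A(3)] by (rule card_image)
  then show ?case using A by (simp add: power2_eq_square algebra_simps)
next
  case (Suc k)
  define m :: nat where "m = 2 ^ k"
  define n where "n = real (Suc q)"
  define \<beta> where "\<beta> = (\<lambda>k. real (card (iterated_sumset k A) * card (iterated_sumset k (f ` A))))"
  have "m > 0" by (simp add: m_def)
  have IH: "n ^ (3 * (m - 1) + 2) \<le> 100 ^ (m - 1) * \<beta> (Suc k) ^ m"
    using Suc.IH unfolding n_def m_def \<beta>_def .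
  have step: "\<beta> (Suc k) * n ^ 3 \<le> 100 * \<beta> (Suc (Suc k)) ^ 2"
    using sumset_growth[OF assms, of "Suc k"] unfolding \<beta>_def n_def .
  have exps: "3 * (2 * m - 1) + 2 = (3 * (m - 1) + 2) + 3 * m" "2 * m - 1 = (m - 1) + m"
    using \<open>m > 0\<close> by simp_all
  have "n ^ (3 * (2 * m - 1) + 2) = n ^ (3 * (m - 1) + 2) * (n ^ 3) ^ m"
    unfolding exps(1) power_add power_mult ..
  also have "\<dots> \<le> (100 ^ (m - 1) * \<beta> (Suc k) ^ m) * (n ^ 3) ^ m"
    using IH by (intro mult_right_mono) (auto simp: n_def)
  also have "\<dots> = 100 ^ (m - 1) * (\<beta> (Suc k) * n ^ 3) ^ m"
    by (simp add: power_mult_distrib)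
  also have "\<dots> \<le> 100 ^ (m - 1) * (100 * \<beta> (Suc (Suc k)) ^ 2) ^ m"
    using step by (intro mult_left_mono power_mono) (auto simp: n_def \<beta>_def)
  also have "\<dots> = 100 ^ (2 * m - 1) * \<beta> (Suc (Suc k)) ^ (2 * m)"
    unfolding exps(2) power_add power_mult by (simp add: power_mult_distrib)
  finally show ?case unfolding n_def m_def \<beta>_def by simp
qed

text \<open>Growth is applied to the inverse of \<open>fwd_diff f e\<close> on a set
  \<open>D e\<close> of its values, for one popular gap \<open>e\<close> of \<open>A\<close>.
  Squeezing into the gaps of f(A) bounds the local part of 2D - D on average over the popular gaps.
  The exponent 41 is 2 * 15 from the class size q^2/N plus 11 from the doubling bound 4M/q.\<close>

lemma structured_growth:
  assumes growth: "\<And>J h B \<tau>. convex J \<Longrightarrow> k_convex_on 3 J h \<Longrightarrow> finite B \<Longrightarrow> B \<noteq> {} \<Longrightarrow> B \<subseteq> J \<Longrightarrow>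
      real (card (local_diff 2 1 B)) \<le> \<tau> \<Longrightarrow>
      c * real (card B) ^ 15 \<le> real (card (local_diff 8 7 (h ` B))) * \<tau> ^ 11"
    and "c > 0"
    and f: "convex_inverse_differences I f"
    and A: "finite A" "A \<subseteq> I" "strict_mono_on A f" "card A = Suc q" "0 < q"
  shows "c / (4 ^ 11 * 16 ^ 15) * real q ^ 41
    \<le> real (card (sumset_diff 8 7 A)) * real (card (sumset_diff 2 1 A)) ^ 15
      * real (card (sumset_diff 4 3 (f ` A))) ^ 11"
proof -
  obtain x where x: "strict_mono_on {..q} x" "x ` {..q} = A"
    using ex_strict_mono_enumeration[OF A(1,4)] by blast
  have xA: "x i \<in> A" if "i \<le> q" for i using x(2) that by auto
  define y where "y = (\<lambda>i. f (x i))"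
  have y: "strict_mono_on {..q} y"
    unfolding y_def using xA strict_mono_onD[OF x(1)]
    by (intro strict_mono_onI strict_mono_onD[OF A(3)]) auto
  define T where "T = local_diff 2 1 A"
  define \<theta> where "\<theta> = real q ^ 2 / (8 * real (card T))"
  define M where "M = card (sumset_diff 4 3 (f ` A))"
  have "finite T" using A by (simp add: T_def)
  have "card T > 0"
    using card_le_card_local_diff[OF A(1), of 1] A(4) by (simp add: T_def numeral_2_eq_2)
  then have \<theta>: "\<theta> > 0" "8 * real (card T) * \<theta> \<le> real q ^ 2"
    using A by (auto simp: \<theta>_def)
  obtain E L H where E: "finite E" "\<And>e. e \<in> E \<Longrightarrow> 0 < e"
    and L: "\<And>e. e \<in> E \<Longrightarrow> L e \<subseteq> {i \<in> {..<q}. x (Suc i) - x i = e}"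
    and H: "\<And>e. e \<in> E \<Longrightarrow> H e \<subseteq> {i \<in> {..<q}. x (Suc i) - x i = e}"
    and cardL: "\<And>e. e \<in> E \<Longrightarrow> \<theta> \<le> 2 * card (L e)"
    and cardH: "q \<le> 4 * (\<Sum>e\<in>E. card (H e))"
    and LH: "\<And>e i j. e \<in> E \<Longrightarrow> i \<in> L e \<Longrightarrow> j \<in> H e \<Longrightarrow> y (Suc i) - y i \<le> y (Suc j) - y j"
  proof (rule squeeze[OF x(1) \<open>finite T\<close> _ \<theta>, of y])
    show "x i + (x (Suc j) - x j) \<in> T" if "i < q" "j < q" "x (Suc j) - x j \<le> x (Suc i) - x i" for i j
      using add_gap_mem_local_diff[OF x(1) that] x(2) by (simp add: T_def)
  qed (use that in blast)
  have neL: "L e \<noteq> {}" if "e \<in> E" for e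
    using cardL[OF that] \<theta> by auto
  define D where "D = (\<lambda>e. (\<lambda>i. y (Suc i) - y i) ` L e)"
  have "(\<Sum>e\<in>E. card (H e) * card (local_diff 2 1 (D e))) \<le> card (local_diff (Suc (2 + 1)) (2 + 1) (y ` {..q}))"
    unfolding D_def by (rule squeeze_local_diff[OF y \<open>finite E\<close> L neL H LH])
  also have "y ` {..q} = f ` A" using x(2) by (auto simp: y_def)
  also have "card (local_diff (Suc (2 + 1)) (2 + 1) (f ` A)) \<le> M"
    using card_local_diff_le[of "f ` A" 4 3] A(1) by (simp add: M_def)
  finally have sum_le: "(\<Sum>e\<in>E. card (H e) * card (local_diff 2 1 (D e))) \<le> M" .
  \<comment> \<open>Pigeonhole: the sizes of the \<open>H e\<close> are weights adding up to at
    least \<open>q / 4\<close>, so if every product exceeded \<open>4 * M\<close>, then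
    \<open>sum_le\<close> would fail.\<close>
  have "\<exists>e\<in>E. q * card (local_diff 2 1 (D e)) \<le> 4 * M"
  proof (rule ccontr)
    assume "\<not> ?thesis"
    then have *: "4 * M + 1 \<le> q * card (local_diff 2 1 (D e))" if "e \<in> E" for e
      using that by (fastforce simp: not_le)
    have "(\<Sum>e\<in>E. card (H e)) * (4 * M + 1) = (\<Sum>e\<in>E. card (H e) * (4 * M + 1))"
      by (rule sum_distrib_right)
    also have "\<dots> \<le> (\<Sum>e\<in>E. card (H e) * (q * card (local_diff 2 1 (D e))))"
      using * by (intro sum_mono mult_le_mono2)
    also have "\<dots> = q * (\<Sum>e\<in>E. card (H e) * card (local_diff 2 1 (D e)))"
      by (simp add: sum_distrib_left mult.left_commute)
    also have "\<dots> \<le> q * M" using sum_le by simp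
    also have "\<dots> \<le> (\<Sum>e\<in>E. card (H e)) * (4 * M)"
      using mult_le_mono1[OF cardH, of M] by (simp add: mult_ac)
    finally have "(\<Sum>e\<in>E. card (H e)) = 0" by simp
    then show False using cardH \<open>0 < q\<close> by linarith
  qed
  then obtain e where e: "e \<in> E" "q * card (local_diff 2 1 (D e)) \<le> 4 * M" by blast
  define \<tau> where "\<tau> = 4 * real M / real q"
  have "real (q * card (local_diff 2 1 (D e))) \<le> real (4 * M)" using e(2) by (rule of_nat_mono)
  then have \<tau>: "real (card (local_diff 2 1 (D e))) \<le> \<tau>"
    using \<open>0 < q\<close> by (simp add: \<tau>_def field_simps)
  obtain J g where J: "convex J" "k_convex_on 3 J g"
    and g: "\<And>z. z \<in> I \<Longrightarrow> fwd_diff f e z \<in> J \<and> g (fwd_diff f e z) = z"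
    using f E(2)[OF e(1)] unfolding convex_inverse_differences_def by metis
  have D_eq: "D e = fwd_diff f e ` x ` L e"
    unfolding D_def image_image fwd_diff_def y_def using L[OF e(1)] by (intro image_cong) auto
  have xL: "x ` L e \<subseteq> A" using L[OF e(1)] xA by auto
  then have xLI: "x ` L e \<subseteq> I" using A by auto
  \<comment> \<open>The left inverse carries \<open>D e\<close> back to the left endpoints of the
    gaps. Their number is \<open>card (L e)\<close>, so \<open>D e\<close> has at least that many
    elements.\<close>
  have gD: "g ` D e = x ` L e"
    unfolding D_eq image_image using xLI g by (force simp: image_iff)
  have finL: "finite (L e)" using L[OF e(1)] by (rule finite_subset) auto
  have "card (L e) = card (x ` L e)"
    using L[OF e(1)] by (intro card_image[symmetric] inj_on_subset[OF strict_mono_on_imp_inj_on[OF x(1)]]) auto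
  also have "\<dots> \<le> card (D e)"
    unfolding gD[symmetric] using finL by (intro card_image_le) (simp add: D_def)
  finally have "\<theta> / 2 \<le> real (card (D e))" using cardL[OF e(1)] by simp
  then have "c * (\<theta> / 2) ^ 15 \<le> c * real (card (D e)) ^ 15"
    using \<open>c > 0\<close> \<theta> by (intro mult_left_mono power_mono) auto
  also have "\<dots> \<le> real (card (local_diff 8 7 (g ` D e))) * \<tau> ^ 11"
    using finL neL[OF e(1)] xLI g \<tau> by (intro growth[OF J]) (auto simp: D_eq)
  also have "\<dots> \<le> real (card (sumset_diff 8 7 A)) * \<tau> ^ 11"
  proof (intro mult_right_mono of_nat_mono)
    have "local_diff 8 7 (g ` D e) \<subseteq> sumset_diff 8 7 A"
      using sumset_diff_mono[OF xL] unfolding gD local_diff_def by auto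
    then show "card (local_diff 8 7 (g ` D e)) \<le> card (sumset_diff 8 7 A)"
      using A by (intro card_mono) auto
  qed (simp add: \<tau>_def)
  finally have 1: "c * (\<theta> / 2) ^ 15 \<le> real (card (sumset_diff 8 7 A)) * \<tau> ^ 11" .
  define N where "N = real (card (sumset_diff 2 1 A))"
  have "real (card T) \<le> N" using A by (simp add: N_def T_def card_local_diff_le)
  then have "N > 0" using \<open>card T > 0\<close> by linarith
  have "real q ^ 2 / (16 * N) \<le> \<theta> / 2"
    using \<open>card T > 0\<close> \<open>real (card T) \<le> N\<close> by (auto simp: \<theta>_def intro!: divide_left_mono)
  then have "c * (real q ^ 2 / (16 * N)) ^ 15 \<le> c * (\<theta> / 2) ^ 15"
    using \<open>c > 0\<close> \<open>N > 0\<close> by (intro mult_left_mono power_mono) auto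
  with 1 have "c * (real q ^ 2 / (16 * N)) ^ 15 \<le> real (card (sumset_diff 8 7 A)) * \<tau> ^ 11"
    by linarith
  then have "c * (real q ^ 2 / (16 * N)) ^ 15 * (N ^ 15 * real q ^ 11)
      \<le> real (card (sumset_diff 8 7 A)) * \<tau> ^ 11 * (N ^ 15 * real q ^ 11)"
    using \<open>N > 0\<close> by (intro mult_right_mono) auto
  also have "c * (real q ^ 2 / (16 * N)) ^ 15 * (N ^ 15 * real q ^ 11) = c / 16 ^ 15 * real q ^ 41"
    using \<open>N > 0\<close> by (simp add: power_divide power_mult_distrib flip: power_mult power_add)
  also have "real (card (sumset_diff 8 7 A)) * \<tau> ^ 11 * (N ^ 15 * real q ^ 11)
      = 4 ^ 11 * (real (card (sumset_diff 8 7 A)) * N ^ 15 * real M ^ 11)"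
    using \<open>0 < q\<close> by (simp add: \<tau>_def power_divide power_mult_distrib)
  finally show ?thesis by (simp add: N_def M_def field_simps)
qed

section \<open>The lower bound\<close>

text \<open>Here P = |8A|, Q = |8f(A)|, N = |2A - A|, M1 = |4f(A) - 3f(A)|, M2 = |8A - 7A|. Sixteen
  factors P go to M2 and the fifteen N, eleven factors Q to the M1. Five more Q, each at most M,
  make the exponents of P and Q equal, so that only the product PQ has to be bounded below. In total
  2 + 30 + 22 + 5 = 59.\<close>

lemma combined_bound:
  fixes P Q N M1 M2 M :: real
  assumes nonneg: "0 \<le> P" "0 \<le> Q" "0 \<le> N" "0 \<le> M1" "0 \<le> M2" "0 \<le> M" "0 \<le> c"
    and s: "c \<le> M2 * N ^ 15 * M1 ^ 11"
    and t: "P * N \<le> M ^ 2" "Q * M1 \<le> M ^ 2" "P * M2 \<le> M ^ 2" "Q \<le> M"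
  shows "c * (P * Q) ^ 16 \<le> M ^ 59"
proof -
  have "c * (P * Q) ^ 16 = c * (P ^ 16 * Q ^ 16)" by (simp add: power_mult_distrib)
  also have "\<dots> \<le> (M2 * N ^ 15 * M1 ^ 11) * (P ^ 16 * Q ^ 16)"
    using s nonneg by (intro mult_right_mono) auto
  also have "\<dots> = (P * M2) * ((P * N) ^ 15 * ((Q * M1) ^ 11 * Q ^ 5))"
    by (simp add: power_mult_distrib eval_nat_numeral mult_ac)
  also have "\<dots> \<le> M ^ 2 * ((M ^ 2) ^ 15 * ((M ^ 2) ^ 11 * M ^ 5))"
    using nonneg t by (intro mult_mono power_mono mult_nonneg_nonneg zero_le_power) auto
  also have "\<dots> = M ^ 59" by (simp flip: power_mult power_add)
  finally show ?thesis .
qed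

text \<open>The eighth power turns (PQ)^16 into the (PQ)^128 of \<open>lower\<close>. Then 8 * 41 +
  383 = 711 and 8 * 59 = 472; the factor 2^328 comes from \<open>n / 2 \<le> q\<close>.\<close>

lemma combined_power_bound:
  fixes P Q N M1 M2 M n q c C :: real
  assumes nonneg: "0 \<le> P" "0 \<le> Q" "0 \<le> N" "0 \<le> M1" "0 \<le> M2" "0 \<le> M" "0 \<le> c" "0 \<le> n" "0 \<le> q"
    and s: "c * q ^ 41 \<le> M2 * N ^ 15 * M1 ^ 11"
    and t: "P * N \<le> M ^ 2" "Q * M1 \<le> M ^ 2" "P * M2 \<le> M ^ 2" "Q \<le> M"
    and lower: "n ^ 383 \<le> C * (P * Q) ^ 128" "0 < C"
    and "n \<le> 2 * q"
  shows "c ^ 8 / (2 ^ 328 * C) * n ^ 711 \<le> M ^ 472"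
proof -
  define b where "b = P * Q"
  have "0 \<le> b" using nonneg by (simp add: b_def)
  have "c * q ^ 41 * b ^ 16 \<le> M ^ 59"
    unfolding b_def using nonneg by (intro combined_bound[OF _ _ _ _ _ _ _ s t]) auto
  then have "(c * q ^ 41 * b ^ 16) ^ 8 \<le> (M ^ 59) ^ 8"
    using nonneg \<open>0 \<le> b\<close> by (intro power_mono) auto
  also have "(c * q ^ 41 * b ^ 16) ^ 8 = c ^ 8 * q ^ 328 * b ^ 128"
    by (simp add: power_mult_distrib flip: power_mult)
  also have "(M ^ 59) ^ 8 = M ^ 472" by (simp flip: power_mult)
  finally have upper: "c ^ 8 * q ^ 328 * b ^ 128 \<le> M ^ 472" .
  have 1: "(n / 2) ^ 328 \<le> q ^ 328" using assms by (intro power_mono) auto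
  have 2: "n ^ 383 / C \<le> b ^ 128"
    using lower by (simp add: b_def divide_le_eq mult.commute)
  have "c ^ 8 / (2 ^ 328 * C) * n ^ 711 = c ^ 8 * ((n ^ 328 / 2 ^ 328) * (n ^ 383 / C))"
  proof -
    have "n ^ 711 = n ^ 328 * n ^ 383" by (simp flip: power_add)
    moreover have "a / (d * C) * (u * v) = a * ((u / d) * (v / C))" for a d u v by simp
    ultimately show ?thesis by (simp only:)
  qed
  also have "\<dots> = c ^ 8 * ((n / 2) ^ 328 * (n ^ 383 / C))" by (simp only: power_divide)
  also have "\<dots> \<le> c ^ 8 * (q ^ 328 * b ^ 128)"
    using nonneg lower(2) by (intro mult_left_mono[OF mult_mono[OF 1 2]]) auto
  also have "\<dots> = c ^ 8 * q ^ 328 * b ^ 128" by (rule mult.assoc[symmetric])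
  also note upper
  finally show ?thesis .
qed

text \<open>\<open>M\<close> dominates all sumsets involved: with third sets 8A and 8f(A), Ruzsa's
  inequality calls for at most 8 + 8 = 16 summands from \<open>A\<close> and 4 + 8 = 12 from
  f(A).\<close>

lemma power_bound:
  obtains \<kappa> :: real where "\<kappa> > 0"
    "\<And>I f A M. convex_inverse_differences I f \<Longrightarrow> finite A \<Longrightarrow> A \<noteq> {} \<Longrightarrow> A \<subseteq> I \<Longrightarrow> strict_mono_on A f \<Longrightarrow>
      real (card (iterated_sumset 16 A)) \<le> M \<Longrightarrow> real (card (iterated_sumset 13 (f ` A))) \<le> M \<Longrightarrow>
      \<kappa> * real (card A) ^ 711 \<le> M ^ 472"
proof -
  obtain c where "c > 0" and growth: "\<And>J h B \<tau>. convex J \<Longrightarrow> k_convex_on 3 J h \<Longrightarrow> finite B \<Longrightarrow> B \<noteq> {} \<Longrightarrow>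
      B \<subseteq> J \<Longrightarrow> real (card (local_diff 2 1 B)) \<le> \<tau> \<Longrightarrow>
      c * real (card B) ^ 15 \<le> real (card (local_diff 8 7 (h ` B))) * \<tau> ^ 11"
    using growth_3 unfolding growth_def by auto
  define c1 where "c1 = c / (4 ^ 11 * 16 ^ 15)"
  define C :: real where "C = 100 ^ 127"
  \<comment> \<open>The minimum with 1 covers sets \<open>A\<close> with one element.\<close>
  define \<kappa> where "\<kappa> = min 1 (c1 ^ 8 / (2 ^ 328 * C))"
  have pos: "c1 > 0" "C > 0" "\<kappa> > 0" using \<open>c > 0\<close> by (auto simp: c1_def C_def \<kappa>_def)
  have "\<kappa> * real (card A) ^ 711 \<le> M ^ 472"
    if f: "convex_inverse_differences I f"
      and A: "finite A" "A \<noteq> {}" "A \<subseteq> I" "strict_mono_on A f"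
      and M: "real (card (iterated_sumset 16 A)) \<le> M" "real (card (iterated_sumset 13 (f ` A))) \<le> M"
    for I f A M
  proof -
    have card_A: "real (card (iterated_sumset k A)) \<le> M" if "k \<le> 16" for k
      using card_iterated_sumset_mono[OF A(1,2) that] M(1) by linarith
    have card_fA: "real (card (iterated_sumset k (f ` A))) \<le> M" if "k \<le> 13" for k
      using card_iterated_sumset_mono[of "f ` A", OF _ _ that] A M(2) by fastforce
    have "card A > 0" using A by (simp add: card_gt_0_iff)
    then obtain q where q: "card A = Suc q" by (metis gr0_conv_Suc)
    have "M \<ge> 1" using card_A[of 1] q by simp
    show ?thesis
    proof (cases "q = 0")
      case True
      have "\<kappa> * real (card A) ^ 711 \<le> 1" using q True by (simp add: \<kappa>_def)
      also have "1 \<le> M ^ 472" using \<open>M \<ge> 1\<close> by (rule one_le_power)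
      finally show ?thesis .
    next
      case False
      define n where "n = real (card A)"
      define P where "P = real (card (iterated_sumset 8 A))"
      define Q where "Q = real (card (iterated_sumset 8 (f ` A)))"
      define M2 where "M2 = real (card (sumset_diff 8 7 A))"
      define N where "N = real (card (sumset_diff 2 1 A))"
      define M1 where "M1 = real (card (sumset_diff 4 3 (f ` A)))"
      have tri: "real (card (iterated_sumset k X)) * real (card (sumset_diff m l X)) \<le> M ^ 2"
        if "finite X" "real (card (iterated_sumset (m + k) X)) \<le> M" "real (card (iterated_sumset (l + k) X)) \<le> M"
        for k m l X
      proof -
        have "real (card (iterated_sumset k X)) * real (card (sumset_diff m l X))
          \<le> real (card (iterated_sumset (m + k) X)) * real (card (iterated_sumset (l + k) X))"
          using of_nat_mono[OF card_sumset_diff_le[OF that(1)], where 'a = real] by simp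
        also have "\<dots> \<le> M * M" using that \<open>M \<ge> 1\<close> by (intro mult_mono) auto
        finally show ?thesis by (simp add: power2_eq_square)
      qed
      have "c1 ^ 8 / (2 ^ 328 * C) * n ^ 711 \<le> M ^ 472"
      proof (rule combined_power_bound[of P Q N M1 M2 M c1 n "real q" C])
        \<comment> \<open>\<open>k = 7\<close> in \<open>sumset_lower_bound\<close> brings in the
          eightfold sumsets.\<close>
        have "3 * (2 ^ 7 - 1) + 2 = (383 :: nat)" "2 ^ 7 - 1 = (127 :: nat)" "2 ^ 7 = (128 :: nat)" "Suc 7 = 8"
          by simp_all
        then show "n ^ 383 \<le> C * (P * Q) ^ 128"
          using sumset_lower_bound[OF f A(1,3,4) q, of 7] False
          unfolding n_def q C_def P_def Q_def of_nat_mult by (simp only: neq0_conv simp_thms)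
        show "c1 * real q ^ 41 \<le> M2 * N ^ 15 * M1 ^ 11"
          unfolding c1_def M1_def M2_def N_def
        proof (rule structured_growth[OF _ \<open>c > 0\<close> f A(1,3,4) q])
          show "c * real (card B) ^ 15 \<le> real (card (local_diff 8 7 (h ` B))) * \<tau> ^ 11"
            if "convex J" "k_convex_on 3 J h" "finite B" "B \<noteq> {}" "B \<subseteq> J" "real (card (local_diff 2 1 B)) \<le> \<tau>"
            for J h B \<tau>
            using that by (rule growth)
        qed (use False in simp)
        show "P * N \<le> M ^ 2" unfolding P_def N_def by (rule tri) (use A card_A in auto)
        show "P * M2 \<le> M ^ 2" unfolding P_def M2_def by (rule tri) (use A card_A in auto)
        show "Q * M1 \<le> M ^ 2" unfolding Q_def M1_def by (rule tri) (use A card_fA in auto)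
        show "Q \<le> M" unfolding Q_def by (rule card_fA) simp
        show "n \<le> 2 * real q" using False by (simp add: n_def q)
      qed (use pos \<open>M \<ge> 1\<close> in \<open>auto simp: P_def Q_def N_def M1_def M2_def n_def\<close>)
      moreover have "\<kappa> * n ^ 711 \<le> c1 ^ 8 / (2 ^ 328 * C) * n ^ 711"
        unfolding \<kappa>_def n_def by (intro mult_right_mono min.cobounded2 zero_le_power of_nat_0_le_iff)
      ultimately show ?thesis unfolding n_def by (rule order_trans[rotated])
    qed
  qed
  then show thesis using that pos(3) by blast
qed

section \<open>Consequences of strict convexity, and the final bound\<close>

lemma strictly_convex_on_imp_convex_on:
  assumes "strictly_convex_on S f"
  shows "convex_on S f"
proof (rule convex_onI)
  show "convex S" using assms by (simp add: strictly_convex_on_def)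
  fix t x y :: real assume "0 < t" "t < 1" "x \<in> S" "y \<in> S"
  show "f ((1 - t) *\<^sub>R x + t *\<^sub>R y) \<le> (1 - t) * f x + t * f y"
  proof (cases "x = y")
    case True
    then show ?thesis by (simp add: algebra_simps)
  next
    case False
    have "f ((1 - t) *\<^sub>R x + t *\<^sub>R y) < (1 - t) * f x + t * f y"
      using assms \<open>0 < t\<close> \<open>t < 1\<close> \<open>x \<in> S\<close> \<open>y \<in> S\<close> False
      unfolding strictly_convex_on_def by auto
    then show ?thesis by simp
  qed
qed

lemma strictly_convex_on_between:
  assumes "strictly_convex_on S f" "x \<in> S" "y \<in> S" "x < z" "z < y"
  shows "(y - x) * f z < (y - z) * f x + (z - x) * f y"
proof -
  define u where "u = (y - z) / (y - x)"
  define v where "v = (z - x) / (y - x)"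
  have scaled: "(y - x) * u = y - z" "(y - x) * v = z - x" using assms by (simp_all add: u_def v_def)
  have uv: "u > 0" "v > 0" using assms by (simp_all add: u_def v_def)
  have "(y - x) * (u + v) = y - x" using scaled by (simp add: distrib_left)
  then have "u + v = 1" using assms by simp
  have "(y - x) * (u * x + v * y) = (y - x) * u * x + (y - x) * v * y" by (simp add: algebra_simps)
  also have "\<dots> = (y - x) * z" unfolding scaled by (simp add: algebra_simps)
  finally have "u * x + v * y = z" using assms by simp
  then have "f z < u * f x + v * f y"
    using assms uv \<open>u + v = 1\<close> unfolding strictly_convex_on_def by force
  then have "(y - x) * f z < (y - x) * (u * f x + v * f y)" using assms by simp
  also have "\<dots> = (y - x) * u * f x + (y - x) * v * f y" by (simp add: algebra_simps)
  also have "\<dots> = (y - z) * f x + (z - x) * f y" unfolding scaled ..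
  finally show ?thesis .
qed

lemma strictly_convex_on_less_max:
  assumes "strictly_convex_on S f" "x \<in> S" "y \<in> S" "x < z" "z < y"
  shows "f z < max (f x) (f y)"
proof -
  have "(y - x) * f z < (y - z) * f x + (z - x) * f y"
    by (rule strictly_convex_on_between[OF assms])
  also have "\<dots> \<le> (y - z) * max (f x) (f y) + (z - x) * max (f x) (f y)"
    using assms by (intro add_mono mult_left_mono) auto
  also have "\<dots> = (y - x) * max (f x) (f y)" by (simp add: algebra_simps)
  finally show ?thesis using assms by simp
qed

text \<open>Both \<open>x + d\<close> and \<open>y\<close> lie between \<open>x\<close> and
  \<open>y + d\<close>. In the sum of the two chord inequalities the weights of either endpoint add
  up to the full length \<open>l\<close>, so the difference at \<open>x\<close> is smaller than at
  \<open>y\<close>.\<close>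

lemma strictly_convex_on_inj_fwd_diff:
  assumes f: "strictly_convex_on S f" and "d > 0" and S: "\<And>x. x \<in> S \<Longrightarrow> x + d \<in> S"
  shows "inj_on (fwd_diff f d) S"
proof (rule linorder_inj_onI)
  fix x y assume "x < y" "x \<in> S" "y \<in> S"
  define l where "l = y + d - x"
  have 1: "l * f (x + d) < (y - x) * f x + d * f (y + d)"
    using strictly_convex_on_between[OF f \<open>x \<in> S\<close> S[OF \<open>y \<in> S\<close>], of "x + d"] \<open>x < y\<close> \<open>d > 0\<close>
    by (simp add: l_def)
  have 2: "l * f y < d * f x + (y - x) * f (y + d)"
    using strictly_convex_on_between[OF f \<open>x \<in> S\<close> S[OF \<open>y \<in> S\<close>], of y] \<open>x < y\<close> \<open>d > 0\<close>
    by (simp add: l_def)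
  have "l * (f (x + d) + f y) < l * (f x + f (y + d))"
    using 1 2 by (simp add: l_def algebra_simps)
  then have "f (x + d) + f y < f x + f (y + d)" using \<open>x < y\<close> \<open>d > 0\<close> by (simp add: l_def)
  then show "fwd_diff f d x \<noteq> fwd_diff f d y" by (simp add: fwd_diff_def)
qed auto

text \<open>A convex or concave function on an open interval is continuous, so the range of each
  difference is connected and hence convex. Strictness makes the differences injective, so
  \<open>the_inv_into\<close> is a left inverse.\<close>

lemma convex_inverse_differencesI:
  assumes f: "strictly_convex_on {a<..} f \<or> strictly_concave_on {a<..} f"
    and inv: "\<And>d. d > 0 \<Longrightarrow> k_convex_on 3 (fwd_diff f d ` {a<..}) (the_inv_into {a<..} (fwd_diff f d))"
  shows "convex_inverse_differences {a<..} f"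
  unfolding convex_inverse_differences_def
proof (intro allI impI)
  fix d :: real assume "d > 0"
  have "continuous_on {a<..} f"
    using f
  proof
    assume "strictly_convex_on {a<..} f"
    then show ?thesis by (intro convex_on_continuous strictly_convex_on_imp_convex_on) auto
  next
    assume "strictly_concave_on {a<..} f"
    then have "continuous_on {a<..} (\<lambda>x. - f x)"
      unfolding strictly_concave_on_def by (intro convex_on_continuous strictly_convex_on_imp_convex_on) auto
    from continuous_on_minus[OF this] show ?thesis by simp
  qed
  moreover from this have "continuous_on {a<..} (\<lambda>x. f (x + d))"
    by (rule continuous_on_compose2) (use \<open>d > 0\<close> in \<open>auto intro!: continuous_intros\<close>)
  ultimately have "continuous_on {a<..} (fwd_diff f d)"
    unfolding fwd_diff_def by (intro continuous_on_diff)
  then have "connected (fwd_diff f d ` {a<..})" by (rule connected_continuous_image) simp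
  then have "convex (fwd_diff f d ` {a<..})" by (simp flip: connected_convex_1)
  moreover have "inj_on (fwd_diff f d) {a<..}"
    using f
  proof
    assume "strictly_convex_on {a<..} f"
    then show ?thesis by (rule strictly_convex_on_inj_fwd_diff) (use \<open>d > 0\<close> in auto)
  next
    assume "strictly_concave_on {a<..} f"
    then have "inj_on (fwd_diff (\<lambda>x. - f x) d) {a<..}"
      unfolding strictly_concave_on_def
      by (rule strictly_convex_on_inj_fwd_diff) (use \<open>d > 0\<close> in auto)
    then show ?thesis unfolding inj_on_def fwd_diff_def by (smt (verit))
  qed
  ultimately show "\<exists>J g. convex J \<and> k_convex_on 3 J g \<and>
      (\<forall>x\<in>{a<..}. fwd_diff f d x \<in> J \<and> g (fwd_diff f d x) = x)"
    using inv[OF \<open>d > 0\<close>] by (intro exI conjI ballI) (auto simp: the_inv_into_f_f)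
qed

text \<open>Cut \<open>A\<close> at a minimizer of \<open>f\<close> on \<open>A\<close>: by strict
  convexity \<open>f\<close> increases to the right and decreases to the left of it, and one side
  holds at least half of \<open>A\<close>.\<close>

lemma strictly_convex_on_monotone_half:
  assumes f: "strictly_convex_on S f" and A: "finite A" "A \<noteq> {}" "A \<subseteq> S"
  obtains B where "B \<subseteq> A" "card A \<le> 2 * card B" "strict_mono_on B f \<or> strict_mono_on B (\<lambda>x. - f x)"
proof -
  define m where "m = Min (f ` A)"
  have m_le: "m \<le> f x" if "x \<in> A" for x using that A by (simp add: m_def)
  \<comment> \<open>The minimum may be attained at two points of \<open>A\<close>; taking the
    rightmost keeps the increase on \<open>R\<close> strict.\<close>
  define x0 where "x0 = Max {x \<in> A. f x = m}"
  have "m \<in> f ` A" using A by (simp add: m_def)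
  then have "{x \<in> A. f x = m} \<noteq> {}" by auto
  then have "x0 \<in> {x \<in> A. f x = m}" using A by (auto simp: x0_def simp del: mem_Collect_eq intro!: Max_in)
  then have x0: "x0 \<in> A" "f x0 = m" by auto
  have x0_ge: "x \<le> x0" if "x \<in> A" "f x = m" for x using that A by (simp add: x0_def)
  define R where "R = {x \<in> A. x0 \<le> x}"
  define L where "L = {x \<in> A. x < x0}"
  have "strict_mono_on R f"
  proof (rule strict_mono_onI)
    fix x y assume xy: "x \<in> R" "y \<in> R" "x < y"
    then have "f y \<noteq> m" using x0_ge[of y] by (auto simp: R_def)
    then have "m < f y" using m_le[of y] xy by (auto simp: R_def)
    moreover have "f x < max (f x0) (f y)" if "x \<noteq> x0"
      using xy x0 that A by (intro strictly_convex_on_less_max[OF f]) (auto simp: R_def)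
    ultimately show "f x < f y" using x0 by fastforce
  qed
  moreover have "strict_mono_on L (\<lambda>x. - f x)"
  proof (rule strict_mono_onI)
    fix x y assume xy: "x \<in> L" "y \<in> L" "x < y"
    then have "f y < max (f x) (f x0)"
      using x0 A by (intro strictly_convex_on_less_max[OF f]) (auto simp: L_def)
    then show "- f x < - f y" using m_le[of x] xy x0 by (auto simp: L_def)
  qed
  moreover have "card A = card L + card R"
  proof -
    have "A = L \<union> R" "L \<inter> R = {}" by (auto simp: L_def R_def)
    then show ?thesis using A by (metis card_Un_disjoint finite_Un)
  qed
  then have "card A \<le> 2 * card L \<or> card A \<le> 2 * card R" by linarith
  moreover have "L \<subseteq> A" "R \<subseteq> A" by (auto simp: L_def R_def)
  ultimately show thesis using that by blast
qed

theorem theorem5p1: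
  shows "\<exists>c\<^sub>0>0. \<exists>c>0. \<forall>(a::real) (A::real set) (f::real \<Rightarrow> real).
    A \<subseteq> {a<..} \<longrightarrow> finite A \<longrightarrow> card A \<ge> 2 \<longrightarrow>
    strictly_convex_on {a<..} f \<or> strictly_concave_on {a<..} f \<longrightarrow>
    (\<forall>d>0. k_convex_on 3 (fwd_diff f d ` {a<..}) (the_inv_into {a<..} (fwd_diff f d))) \<longrightarrow>
    (let Y = real (card A) powr (3/2 + 1/162)
     in real (max (card (iterated_sumset 16 A)) (card (iterated_sumset 13 (f ` A))))
          \<ge> c\<^sub>0 * Y / log 2 Y powr c)"
proof -
  obtain \<kappa> :: real where "\<kappa> > 0" and \<kappa>: "\<And>I f A M. convex_inverse_differences I f \<Longrightarrow> finite A \<Longrightarrow> A \<noteq> {} \<Longrightarrow>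
      A \<subseteq> I \<Longrightarrow> strict_mono_on A f \<Longrightarrow>
      real (card (iterated_sumset 16 A)) \<le> M \<Longrightarrow> real (card (iterated_sumset 13 (f ` A))) \<le> M \<Longrightarrow>
      \<kappa> * real (card A) ^ 711 \<le> M ^ 472"
    using power_bound by blast
  \<comment> \<open>The root of order 472 of \<kappa>, divided by the loss from passing to a subset
    \<open>B\<close> with at least half of \<open>A\<close>.\<close>
  define c0 where "c0 = \<kappa> powr (1/472) / 2 powr (122/81)"
  have "c0 > 0" using \<open>\<kappa> > 0\<close> by (simp add: c0_def)
  have "c0 * Y / log 2 Y powr 1 \<le> M"
    if A: "A \<subseteq> {a<..}" "finite A" "card A \<ge> 2"
      and f: "strictly_convex_on {a<..} f \<or> strictly_concave_on {a<..} f"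
      and inv: "\<forall>d>0. k_convex_on 3 (fwd_diff f d ` {a<..}) (the_inv_into {a<..} (fwd_diff f d))"
      and Y: "Y = real (card A) powr (3/2 + 1/162)"
      and M: "M = real (max (card (iterated_sumset 16 A)) (card (iterated_sumset 13 (f ` A))))"
    for a A f Y M
  proof -
    have "A \<noteq> {}" using A by auto
    have cid: "convex_inverse_differences {a<..} f"
      using inv by (intro convex_inverse_differencesI f) auto
    obtain B where B: "B \<subseteq> A" "card A \<le> 2 * card B"
      "strict_mono_on B f \<or> strict_mono_on B (\<lambda>x. - f x)"
      using f
    proof
      assume "strictly_convex_on {a<..} f"
      from strictly_convex_on_monotone_half[OF this A(2) \<open>A \<noteq> {}\<close> A(1)] that show thesis by blast
    next
      assume "strictly_concave_on {a<..} f"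
      then have "strictly_convex_on {a<..} (\<lambda>x. - f x)" by (simp add: strictly_concave_on_def)
      from strictly_convex_on_monotone_half[OF this A(2) \<open>A \<noteq> {}\<close> A(1)] that show thesis by auto
    qed
    have B': "finite B" "B \<noteq> {}" "B \<subseteq> {a<..}" using B A finite_subset by auto
    have "card (iterated_sumset 16 B) \<le> card (iterated_sumset 16 A)"
      using A B by (intro card_mono iterated_sumset_mono) auto
    then have M16: "real (card (iterated_sumset 16 B)) \<le> M" by (simp add: M)
    have "card (iterated_sumset 13 (f ` B)) \<le> card (iterated_sumset 13 (f ` A))"
      using A B by (intro card_mono iterated_sumset_mono) auto
    then have M13: "real (card (iterated_sumset 13 (f ` B))) \<le> M" by (simp add: M)
    have "\<kappa> * real (card B) ^ 711 \<le> M ^ 472"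
      using B(3)
    proof
      assume "strict_mono_on B f"
      from \<kappa>[OF cid B' this M16 M13] show ?thesis .
    next
      assume mono: "strict_mono_on B (\<lambda>x. - f x)"
      have "(\<lambda>x. - f x) ` B = uminus ` f ` B" by (simp add: image_image)
      then have "real (card (iterated_sumset 13 ((\<lambda>x. - f x) ` B))) \<le> M"
        using M13 by (simp add: iterated_sumset_uminus card_image)
      from \<kappa>[OF convex_inverse_differences_uminus[OF cid] B' mono M16 this] show ?thesis .
    qed
    define n where "n = real (card B)"
    have n: "n \<ge> 1" using B' by (simp add: n_def Suc_le_eq card_gt_0_iff)
    have "M \<ge> 0" by (simp add: M)
    \<comment> \<open>711/472 exceeds 122/81 = 3/2 + 1/162, since 711 * 81 = 57591 and 472 * 122 =
      57584; the base \<open>n\<close> is at least 1.\<close>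
    have "\<kappa> powr (1/472) * n powr (122/81) \<le> \<kappa> powr (1/472) * n powr (711/472)"
      using n by (intro mult_left_mono powr_mono) auto
    also have "n powr (711/472) = (n powr 711) powr (1/472)" by (simp add: powr_powr)
    also have "n powr 711 = n ^ 711" using n by simp
    also have "\<kappa> powr (1/472) * (n ^ 711) powr (1/472) = (\<kappa> * n ^ 711) powr (1/472)"
      using n \<open>\<kappa> > 0\<close> by (simp add: powr_mult)
    also have "\<dots> \<le> (M ^ 472) powr (1/472)"
      using \<open>\<kappa> * real (card B) ^ 711 \<le> M ^ 472\<close> n \<open>\<kappa> > 0\<close> by (intro powr_mono2) (auto simp: n_def)
    also have "(M ^ 472) powr (1/472) = M"
    proof (cases "M = 0")
      case False
      then have "M > 0" using \<open>M \<ge> 0\<close> by simp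
      then have "(M ^ 472) powr (1/472) = (M powr 472) powr (1/472)" by simp
      also have "\<dots> = M" unfolding powr_powr using \<open>M > 0\<close> by simp
      finally show ?thesis .
    qed simp
    finally have lower: "\<kappa> powr (1/472) * n powr (122/81) \<le> M" .
    have Y': "Y = real (card A) powr (122/81)" by (simp add: Y)
    have "Y \<le> (2 * n) powr (122/81)"
      unfolding Y' using of_nat_mono[OF B(2), where 'a = real] by (intro powr_mono2) (auto simp: n_def)
    also have "\<dots> = 2 powr (122/81) * n powr (122/81)" using n by (simp add: powr_mult)
    finally have "c0 * Y \<le> c0 * (2 powr (122/81) * n powr (122/81))"
      using \<open>c0 > 0\<close> by simp
    also have "\<dots> = \<kappa> powr (1/472) * n powr (122/81)" by (simp add: c0_def)
    finally have "c0 * Y \<le> M" using lower by linarith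
    \<comment> \<open>\<open>Y \<ge> 2\<close> because \<open>card A \<ge> 2\<close> and the
      exponent is at least 1. Hence \<open>log 2 Y \<ge> 1\<close>, and dividing by it cannot raise
      the lower bound.\<close>
    have "2 powr 1 \<le> real (card A) powr 1" using A(3) by simp
    also have "\<dots> \<le> Y" unfolding Y' using A(3) by (intro powr_mono) auto
    finally have "Y \<ge> 2" by simp
    then have "log 2 Y \<ge> 1" by (simp add: le_log_iff)
    then have "c0 * Y / log 2 Y powr 1 \<le> c0 * Y / 1"
      using \<open>c0 > 0\<close> \<open>Y \<ge> 2\<close> by (intro divide_left_mono) auto
    then show ?thesis using \<open>c0 * Y \<le> M\<close> by linarith
  qed
  then show ?thesis
    unfolding Let_def using \<open>c0 > 0\<close> by (intro exI[of _ c0] exI[of _ 1] conjI allI impI) auto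
qed

end
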